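(* Let $V$ be a complex vector space with $\dim V=k$, and assume that $|p-q|=mk$ for an integer $m\ge0$. Then $$\dim(V^{\otimes p}\otimes V^{*\otimes q})^{\mathrm{SL}(V)}=\sum_{\mu}\#\mathrm{SYT}(\mu+m^k)\cdot\#\mathrm{SYT}(\mu),$$ where the sum is over partitions $\mu\vdash\min\{p,q\}$ with $\ell(\mu)\le k$, and $\mu+m^k$ is the shape obtained from $\mu$ by adding $m$ boxes to all $k$ rows.
   Context: $\mathrm{SYT}(\mu)$ is the set of standard Young tableaux of shape $\mu$; $\ell(\mu)$ is the number of parts of $\mu$; $\mu$ is regarded as having $k$ rows (some possibly empty) when forming $\mu+m^k=(\mu_1+m,\dots,\mu_k+m)$. *)

theory Defs
  imports
    Complex_Main
    "HOL-Library.FuncSet"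
    "HOL-Library.Function_Algebras"
    "Jordan_Normal_Form.Determinant"
begin

text \<open>
  Functions into the complex numbers form a vector space; addition is the pointwise one of
  \<^theory>\<open>HOL-Library.Function_Algebras\<close>.
\<close>

definition fun_scale :: "complex \<Rightarrow> ('a \<Rightarrow> complex) \<Rightarrow> 'a \<Rightarrow> complex" where
  "fun_scale c f = (\<lambda>x. c * f x)"

lemma vector_space_fun_scale: "vector_space fun_scale"
  by unfold_locales (auto simp: fun_scale_def fun_eq_iff algebra_simps)

lemma vector_space_mult: "vector_space ((*) :: complex \<Rightarrow> complex \<Rightarrow> complex)"
  by unfold_locales (auto simp: algebra_simps)

definition dual_space :: "(complex \<Rightarrow> 'v::ab_group_add \<Rightarrow> 'v) \<Rightarrow> ('v \<Rightarrow> complex) set" where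
  "dual_space s = {\<phi>. Vector_Spaces.linear s (*) \<phi>}"

definition ordered_basis :: "(complex \<Rightarrow> 'v::ab_group_add \<Rightarrow> 'v) \<Rightarrow> 'v list \<Rightarrow> bool" where
  "ordered_basis s bs \<longleftrightarrow>
     distinct bs \<and> \<not> module.dependent s (set bs) \<and> module.span s (set bs) = UNIV"

definition matrix_wrt ::
    "(complex \<Rightarrow> 'v::ab_group_add \<Rightarrow> 'v) \<Rightarrow> 'v list \<Rightarrow> ('v \<Rightarrow> 'v) \<Rightarrow> complex mat" where
  "matrix_wrt s bs g =
     mat (length bs) (length bs) (\<lambda>(i, j). module.representation s (set bs) (g (bs ! j)) (bs ! i))"

text \<open>The value does not depend on the basis that is chosen; see \<open>lin_det_eq\<close> below.\<close>

definition lin_det :: "(complex \<Rightarrow> 'v::ab_group_add \<Rightarrow> 'v) \<Rightarrow> ('v \<Rightarrow> 'v) \<Rightarrow> complex" where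
  "lin_det s g = det (matrix_wrt s (SOME bs. ordered_basis s bs) g)"

lemma representation_linear_image:
  assumes s: "vector_space s" and lin: "Vector_Spaces.linear s s g"
    and b: "ordered_basis s bs" and c: "ordered_basis s cs"
  shows "module.representation s (set cs) (g v) w =
    (\<Sum>j<length bs. module.representation s (set bs) v (bs ! j) *
       module.representation s (set cs) (g (bs ! j)) w)"
proof -
  interpret vector_space s by (rule s)
  interpret g: Vector_Spaces.linear s s g by (rule lin)
  from b c have b': "distinct bs" "independent (set bs)" "span (set bs) = UNIV"
    and c': "distinct cs" "independent (set cs)" "span (set cs) = UNIV"
    by (auto simp: ordered_basis_def)
  have "v = (\<Sum>x\<in>set bs. s (representation (set bs) v x) x)"
    by (rule sum_representation_eq[symmetric]) (use b' in auto)
  then have "g v = (\<Sum>x\<in>set bs. s (representation (set bs) v x) (g x))"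
    by (metis (no_types, lifting) g.scale g.sum sum.cong)
  then have "representation (set cs) (g v) w =
      (\<Sum>x\<in>set bs. representation (set bs) v x * representation (set cs) (g x) w)"
    using c' by (simp add: representation_sum representation_scale)
  also have "\<dots> = (\<Sum>j<length bs. representation (set bs) v (bs ! j) *
       representation (set cs) (g (bs ! j)) w)"
    using bij_betw_nth[OF b'(1) refl refl]
    by (intro sum.reindex_bij_betw[symmetric]) 
  finally show ?thesis .
qed

lemma det_matrix_wrt_eq:
  assumes lin: "Vector_Spaces.linear s s g"
    and b: "ordered_basis s bs" and c: "ordered_basis s cs"
  shows "det (matrix_wrt s bs g) = det (matrix_wrt s cs g)"
proof -
  from lin have s: "vector_space s" by (simp add: Vector_Spaces.linear_iff)
  interpret vector_space s by (rule s)
  define R where "R xs = representation (set xs)" for xs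
  define P where "P xs ys = mat (length ys) (length xs) (\<lambda>(i, j). R ys (xs ! j) (ys ! i))"
    for xs ys
  have lin_id: "Vector_Spaces.linear s s (\<lambda>x. x)"
    by (simp add: Vector_Spaces.linear_iff s)
  from b c have "length bs = card (set bs)" "length cs = card (set cs)"
    by (simp_all add: ordered_basis_def distinct_card)
  moreover from b c have "card (set bs) = dim UNIV" "card (set cs) = dim UNIV"
    by (auto simp: ordered_basis_def intro!: dim_eq_card[symmetric])
  ultimately have len: "length cs = length bs" by simp
  note R = representation_linear_image[OF s, folded R_def]
  have id: "P ys xs * P xs ys = 1\<^sub>m (length xs)"
    if x: "ordered_basis s xs" and y: "ordered_basis s ys" for xs ys
  proof (rule eq_matI)
    fix i j assume "i < dim_row (1\<^sub>m (length xs))" "j < dim_col (1\<^sub>m (length xs))"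
    then have ij: "i < length xs" "j < length xs" by auto
    have "(P ys xs * P xs ys) $$ (i, j) = (\<Sum>k<length ys. R ys (xs ! j) (ys ! k) * R xs (ys ! k) (xs ! i))"
      using ij by (simp add: P_def scalar_prod_def mult.commute lessThan_atLeast0)
    also have "\<dots> = R xs (xs ! j) (xs ! i)"
      by (rule R[OF lin_id y x, symmetric])
    also have "\<dots> = (if i = j then 1 else 0)"
      using x ij by (simp add: R_def representation_basis ordered_basis_def nth_eq_iff_index_eq)
    finally show "(P ys xs * P xs ys) $$ (i, j) = 1\<^sub>m (length xs) $$ (i, j)" using ij by simp
  qed (simp_all add: P_def)
  have conj: "matrix_wrt s cs g * P bs cs = P bs cs * matrix_wrt s bs g"
  proof (rule eq_matI)
    fix i j assume "i < dim_row (P bs cs * matrix_wrt s bs g)" "j < dim_col (P bs cs * matrix_wrt s bs g)"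
    then have ij: "i < length cs" "j < length bs" by (auto simp: P_def matrix_wrt_def)
    have "(matrix_wrt s cs g * P bs cs) $$ (i, j) =
        (\<Sum>k<length cs. R cs (bs ! j) (cs ! k) * R cs (g (cs ! k)) (cs ! i))"
      using ij by (simp add: P_def matrix_wrt_def R_def scalar_prod_def mult.commute lessThan_atLeast0)
    also have "\<dots> = R cs (g (bs ! j)) (cs ! i)"
      by (rule R[OF lin c c, symmetric])
    also have "\<dots> = (\<Sum>k<length bs. R bs (g (bs ! j)) (bs ! k) * R cs (bs ! k) (cs ! i))"
      by (rule R[OF lin_id b c])
    also have "\<dots> = (P bs cs * matrix_wrt s bs g) $$ (i, j)"
      using ij by (simp add: P_def matrix_wrt_def R_def scalar_prod_def mult.commute lessThan_atLeast0)
    finally show "(matrix_wrt s cs g * P bs cs) $$ (i, j) = (P bs cs * matrix_wrt s bs g) $$ (i, j)" .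
  qed (simp_all add: P_def matrix_wrt_def)
  define n where "n = length bs"
  have carr: "P bs cs \<in> carrier_mat n n" "P cs bs \<in> carrier_mat n n"
    "matrix_wrt s bs g \<in> carrier_mat n n" "matrix_wrt s cs g \<in> carrier_mat n n"
    using len by (auto simp: P_def matrix_wrt_def n_def)
  have "det (P cs bs) * det (P bs cs) = 1"
    using id[OF b c] by (simp add: n_def det_mult[OF carr(2,1), symmetric])
  then have nz: "det (P bs cs) \<noteq> 0" by auto
  have "det (matrix_wrt s cs g) * det (P bs cs) = det (P bs cs) * det (matrix_wrt s bs g)"
    using arg_cong[OF conj, of det] by (simp add: det_mult[OF carr(4,1)] det_mult[OF carr(1,3)])
  with nz show ?thesis by simp
qed

lemma lin_det_eq:
  assumes "Vector_Spaces.linear s s g" and "ordered_basis s bs"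
  shows "lin_det s g = det (matrix_wrt s bs g)"
  unfolding lin_det_def
  by (rule det_matrix_wrt_eq) (use assms in \<open>auto intro: someI\<close>)

definition SL :: "(complex \<Rightarrow> 'v::ab_group_add \<Rightarrow> 'v) \<Rightarrow> ('v \<Rightarrow> 'v) set" where
  "SL s = {g. Vector_Spaces.linear s s g \<and> bij g \<and> lin_det s g = 1}"

text \<open>
  Maps \<open>V \<times> \<dots> \<times> V \<times> V* \<times> \<dots> \<times> V* \<rightarrow> W\<close> (\<open>p\<close> factors \<open>V\<close>, \<open>q\<close> factors \<open>V*\<close>) that are linear in each
  argument; \<open>t\<close> is the scalar multiplication of \<open>W\<close>. The arguments are two lists of lengths \<open>p\<close>
  and \<open>q\<close>, and nothing is required of the values of \<open>\<beta>\<close> at other lists.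
\<close>

definition tensor_args ::
    "(complex \<Rightarrow> 'v::ab_group_add \<Rightarrow> 'v) \<Rightarrow> nat \<Rightarrow> nat \<Rightarrow> ('v list \<times> ('v \<Rightarrow> complex) list) set" where
  "tensor_args s p q = {(vs, \<phi>s). length vs = p \<and> length \<phi>s = q \<and> set \<phi>s \<subseteq> dual_space s}"

definition multilinear ::
    "(complex \<Rightarrow> 'v::ab_group_add \<Rightarrow> 'v) \<Rightarrow> (complex \<Rightarrow> 'w::ab_group_add \<Rightarrow> 'w) \<Rightarrow> nat \<Rightarrow> nat \<Rightarrow>
      ('v list \<Rightarrow> ('v \<Rightarrow> complex) list \<Rightarrow> 'w) \<Rightarrow> bool" where
  "multilinear s t p q \<beta> \<longleftrightarrow>
     (\<forall>(vs, \<phi>s) \<in> tensor_args s p q.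
        (\<forall>i<p. \<forall>x y c.
           \<beta> (vs[i := x + y]) \<phi>s = \<beta> (vs[i := x]) \<phi>s + \<beta> (vs[i := y]) \<phi>s \<and>
           \<beta> (vs[i := s c x]) \<phi>s = t c (\<beta> (vs[i := x]) \<phi>s)) \<and>
        (\<forall>j<q. \<forall>\<phi> \<in> dual_space s. \<forall>\<psi> \<in> dual_space s. \<forall>c.
           \<beta> vs (\<phi>s[j := \<phi> + \<psi>]) = \<beta> vs (\<phi>s[j := \<phi>]) + \<beta> vs (\<phi>s[j := \<psi>]) \<and>
           \<beta> vs (\<phi>s[j := fun_scale c \<phi>]) = t c (\<beta> vs (\<phi>s[j := \<phi>]))))"

text \<open>
  The tensor product of \<open>p\<close> copies of \<open>V\<close> and \<open>q\<close> copies of \<open>V*\<close> is realised inside the dual space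
  of the space of multilinear forms: the pure tensor of \<open>vs\<close> and \<open>\<phi>s\<close> is evaluation at
  \<open>(vs, \<phi>s)\<close>, and the tensor product is the span of the pure tensors. Theorems
  \<open>tensor_space_universal\<close> and \<open>tensor_space_unique\<close> below give the universal property.
\<close>

type_synonym 'v tensor = "('v list \<Rightarrow> ('v \<Rightarrow> complex) list \<Rightarrow> complex) \<Rightarrow> complex"

definition pure_tensor ::
    "(complex \<Rightarrow> 'v::ab_group_add \<Rightarrow> 'v) \<Rightarrow> nat \<Rightarrow> nat \<Rightarrow> 'v list \<Rightarrow> ('v \<Rightarrow> complex) list \<Rightarrow> 'v tensor" where
  "pure_tensor s p q vs \<phi>s = (\<lambda>\<beta>. if multilinear s (*) p q \<beta> then \<beta> vs \<phi>s else 0)"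

definition tensor_space ::
    "(complex \<Rightarrow> 'v::ab_group_add \<Rightarrow> 'v) \<Rightarrow> nat \<Rightarrow> nat \<Rightarrow> 'v tensor set" where
  "tensor_space s p q =
     module.span fun_scale ((\<lambda>(vs, \<phi>s). pure_tensor s p q vs \<phi>s) ` tensor_args s p q)"

lemma multilinear_vector:
  assumes "multilinear s t p q \<beta>" and "length vs = p" "length \<phi>s = q" "set \<phi>s \<subseteq> dual_space s" "i < p"
  shows "\<beta> (vs[i := x + y]) \<phi>s = \<beta> (vs[i := x]) \<phi>s + \<beta> (vs[i := y]) \<phi>s"
    and "\<beta> (vs[i := s c x]) \<phi>s = t c (\<beta> (vs[i := x]) \<phi>s)"
  using assms unfolding multilinear_def tensor_args_def by blast+

lemma multilinear_covector:
  assumes "multilinear s t p q \<beta>" and "length vs = p" "length \<phi>s = q" "set \<phi>s \<subseteq> dual_space s" "j < q"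
    and "\<phi> \<in> dual_space s" "\<psi> \<in> dual_space s"
  shows "\<beta> vs (\<phi>s[j := \<phi> + \<psi>]) = \<beta> vs (\<phi>s[j := \<phi>]) + \<beta> vs (\<phi>s[j := \<psi>])"
    and "\<beta> vs (\<phi>s[j := fun_scale c \<phi>]) = t c (\<beta> vs (\<phi>s[j := \<phi>]))"
  using assms unfolding multilinear_def tensor_args_def by blast+

lemma multilinearI:
  assumes "\<And>vs \<phi>s i x y. length vs = p \<Longrightarrow> length \<phi>s = q \<Longrightarrow> set \<phi>s \<subseteq> dual_space s \<Longrightarrow> i < p \<Longrightarrow>
      \<beta> (vs[i := x + y]) \<phi>s = \<beta> (vs[i := x]) \<phi>s + \<beta> (vs[i := y]) \<phi>s"
    and "\<And>vs \<phi>s i c x. length vs = p \<Longrightarrow> length \<phi>s = q \<Longrightarrow> set \<phi>s \<subseteq> dual_space s \<Longrightarrow> i < p \<Longrightarrow>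
      \<beta> (vs[i := s c x]) \<phi>s = t c (\<beta> (vs[i := x]) \<phi>s)"
    and "\<And>vs \<phi>s j \<phi> \<psi>. length vs = p \<Longrightarrow> length \<phi>s = q \<Longrightarrow> set \<phi>s \<subseteq> dual_space s \<Longrightarrow> j < q \<Longrightarrow>
      \<phi> \<in> dual_space s \<Longrightarrow> \<psi> \<in> dual_space s \<Longrightarrow>
      \<beta> vs (\<phi>s[j := \<phi> + \<psi>]) = \<beta> vs (\<phi>s[j := \<phi>]) + \<beta> vs (\<phi>s[j := \<psi>])"
    and "\<And>vs \<phi>s j c \<phi>. length vs = p \<Longrightarrow> length \<phi>s = q \<Longrightarrow> set \<phi>s \<subseteq> dual_space s \<Longrightarrow> j < q \<Longrightarrow>
      \<phi> \<in> dual_space s \<Longrightarrow> \<beta> vs (\<phi>s[j := fun_scale c \<phi>]) = t c (\<beta> vs (\<phi>s[j := \<phi>]))"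
  shows "multilinear s t p q \<beta>"
  using assms by (auto simp: multilinear_def tensor_args_def)

lemma multilinear_linear_compose:
  assumes "Vector_Spaces.linear t u f" and "multilinear s t p q \<beta>"
  shows "multilinear s u p q (\<lambda>vs \<phi>s. f (\<beta> vs \<phi>s))"
  using assms(1)
  by (intro multilinearI)
    (simp_all add: Vector_Spaces.linear_iff multilinear_vector[OF assms(2)] multilinear_covector[OF assms(2)])

lemma multilinear_pure_tensor: "multilinear s fun_scale p q (pure_tensor s p q)"
  by (rule multilinearI)
    (simp_all add: pure_tensor_def fun_eq_iff fun_scale_def multilinear_vector[where t = "(*)"]
      multilinear_covector[where t = "(*)", unfolded fun_scale_def])

lemma linear_forms_separate:
  assumes t: "vector_space t" and "w \<noteq> 0"
  obtains l where "Vector_Spaces.linear t ((*) :: complex \<Rightarrow> complex \<Rightarrow> complex) l" and "l w \<noteq> 0"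
proof -
  interpret vector_space_pair t "(*) :: complex \<Rightarrow> complex \<Rightarrow> complex"
    by (intro vector_space_pair.intro t vector_space_mult)
  have "vs1.independent {w}" using \<open>w \<noteq> 0\<close> by simp
  from linear_independent_extend[OF this, of "\<lambda>_. 1"] show thesis using that by force
qed

theorem tensor_space_universal:
  fixes s :: "complex \<Rightarrow> 'a::ab_group_add \<Rightarrow> 'a"
  assumes t: "vector_space t" and f: "multilinear s t p q f"
  shows "\<exists>F. Vector_Spaces.linear fun_scale t F \<and>
    (\<forall>(vs, \<phi>s) \<in> tensor_args s p q. F (pure_tensor s p q vs \<phi>s) = f vs \<phi>s)"
proof -
  interpret vector_space_pair fun_scale t
    by (intro vector_space_pair.intro t vector_space_fun_scale)
  interpret C: vector_space_pair fun_scale "(*) :: complex \<Rightarrow> complex \<Rightarrow> complex"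
    by (intro vector_space_pair.intro vector_space_mult vector_space_fun_scale)
  let ?pt = "\<lambda>(vs, \<phi>s). pure_tensor s p q vs \<phi>s"
  define S where "S = ?pt ` tensor_args s p q"
  obtain B where B: "B \<subseteq> S" "vs1.independent B" "S \<subseteq> vs1.span B"
    using vs1.maximal_independent_subset[of S] by metis
  have "\<forall>b\<in>B. \<exists>x. x \<in> tensor_args s p q \<and> b = ?pt x"
    using B(1) unfolding S_def by blast
  then obtain h where h: "\<And>b. b \<in> B \<Longrightarrow> h b \<in> tensor_args s p q \<and> b = ?pt (h b)"
    using bchoice[of B "\<lambda>b x. x \<in> tensor_args s p q \<and> b = ?pt x"] by blast
  from linear_independent_extend[OF B(2), of "\<lambda>b. case h b of (vs, \<phi>s) \<Rightarrow> f vs \<phi>s"]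
  obtain F where F: "Vector_Spaces.linear fun_scale t F" and FB: "\<And>b. b \<in> B \<Longrightarrow> F b = (case h b of (vs, \<phi>s) \<Rightarrow> f vs \<phi>s)"
    by blast
  have "F (pure_tensor s p q vs \<phi>s) = f vs \<phi>s" if "(vs, \<phi>s) \<in> tensor_args s p q" for vs \<phi>s
  proof (rule ccontr)
    assume "F (pure_tensor s p q vs \<phi>s) \<noteq> f vs \<phi>s"
    then have "F (pure_tensor s p q vs \<phi>s) - f vs \<phi>s \<noteq> 0" by simp
    then obtain l where l: "Vector_Spaces.linear t ((*) :: complex \<Rightarrow> complex \<Rightarrow> complex) l"
        and nz: "l (F (pure_tensor s p q vs \<phi>s) - f vs \<phi>s) \<noteq> 0"
      by (rule linear_forms_separate[OF t])
    have ml: "multilinear s (*) p q (\<lambda>vs \<phi>s. l (f vs \<phi>s))"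
      by (rule multilinear_linear_compose[OF l f])
    define G :: "'a tensor \<Rightarrow> complex" where "G x = x (\<lambda>vs \<phi>s. l (f vs \<phi>s))" for x
    have lF: "Vector_Spaces.linear fun_scale (*) (\<lambda>x. l (F x))"
      using F l by (simp add: Vector_Spaces.linear_iff)
    have lG: "Vector_Spaces.linear fun_scale (*) G"
      by (simp add: Vector_Spaces.linear_iff vector_space_fun_scale vector_space_mult G_def)
        (simp add: fun_scale_def)
    have eq: "l (F b) = G b" if b: "b \<in> B" for b
    proof -
      obtain ws \<psi>s where hb: "h b = (ws, \<psi>s)" by force
      with h[OF b] have "b = pure_tensor s p q ws \<psi>s" by simp
      with ml show ?thesis
        using FB[OF b] hb by (simp add: pure_tensor_def G_def)
    qed
    have "pure_tensor s p q vs \<phi>s \<in> vs1.span B" using B(3) that by (force simp: S_def)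
    with eq have "l (F (pure_tensor s p q vs \<phi>s)) = G (pure_tensor s p q vs \<phi>s)"
      using C.linear_eq_on[OF lF lG] by blast
    with ml have "l (F (pure_tensor s p q vs \<phi>s)) = l (f vs \<phi>s)" by (simp add: pure_tensor_def G_def)
    then show False
      using nz module_hom.diff[OF l[folded module_hom_iff_linear]] by simp
  qed
  with F show "\<exists>F. Vector_Spaces.linear fun_scale t F \<and>
      (\<forall>(vs, \<phi>s) \<in> tensor_args s p q. F (pure_tensor s p q vs \<phi>s) = f vs \<phi>s)"
    by blast
qed

theorem tensor_space_unique:
  assumes F: "Vector_Spaces.linear fun_scale t F" and G: "Vector_Spaces.linear fun_scale t G"
    and eq: "\<forall>(vs, \<phi>s) \<in> tensor_args s p q. F (pure_tensor s p q vs \<phi>s) = G (pure_tensor s p q vs \<phi>s)"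
    and x: "x \<in> tensor_space s p q"
  shows "F x = G x"
proof -
  from F have "vector_space t" by (simp add: Vector_Spaces.linear_iff)
  then interpret vector_space_pair fun_scale t
    by (intro vector_space_pair.intro vector_space_fun_scale)
  show ?thesis
    by (rule linear_eq_on[OF F G, of _ "(\<lambda>(vs, \<phi>s). pure_tensor s p q vs \<phi>s) ` tensor_args s p q"])
      (use eq x in \<open>auto simp: tensor_space_def\<close>)
qed

text \<open>
  The linear action of \<open>g\<close> with \<open>g\<close> on the factors \<open>V\<close> and the contragredient
  \<open>\<phi> \<mapsto> \<phi> \<circ> g\<^sup>-\<^sup>1\<close> on the factors \<open>V*\<close>; see \<open>tensor_act_pure\<close> below.
\<close>

definition tensor_act :: "('v \<Rightarrow> 'v) \<Rightarrow> 'v tensor \<Rightarrow> 'v tensor" where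
  "tensor_act g t = (\<lambda>\<beta>. t (\<lambda>vs \<phi>s. \<beta> (map g vs) (map (\<lambda>\<phi>. \<phi> \<circ> inv_into UNIV g) \<phi>s)))"

lemma multilinear_compose_act:
  assumes g: "Vector_Spaces.linear s s g" and h: "Vector_Spaces.linear s s h"
    and \<beta>: "multilinear s t p q \<beta>"
  shows "multilinear s t p q (\<lambda>vs \<phi>s. \<beta> (map g vs) (map (\<lambda>\<phi>. \<phi> \<circ> h) \<phi>s))"
proof -
  have d: "\<phi> \<circ> h \<in> dual_space s" if "\<phi> \<in> dual_space s" for \<phi>
    using that h by (simp add: dual_space_def Vector_Spaces.linear_iff)
  have e: "(\<phi> + \<psi>) \<circ> h = (\<phi> \<circ> h) + (\<psi> \<circ> h)" "fun_scale c \<phi> \<circ> h = fun_scale c (\<phi> \<circ> h)" for \<phi> \<psi> c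
    by (auto simp: fun_eq_iff fun_scale_def)
  have d': "set (map (\<lambda>\<phi>. \<phi> \<circ> h) \<phi>s) \<subseteq> dual_space s" if "set \<phi>s \<subseteq> dual_space s" for \<phi>s
    using that d by auto
  show ?thesis
    using g
    by (intro multilinearI)
      (simp_all add: map_update Vector_Spaces.linear_iff e multilinear_vector[OF \<beta> _ _ d']
        multilinear_covector[OF \<beta> _ _ d'] d)
qed

lemma tensor_act_pure:
  assumes "g \<in> SL s"
  shows "tensor_act g (pure_tensor s p q vs \<phi>s) =
    pure_tensor s p q (map g vs) (map (\<lambda>\<phi>. \<phi> \<circ> inv_into UNIV g) \<phi>s)"
proof -
  define h where "h = inv_into UNIV g"
  from assms have g: "Vector_Spaces.linear s s g" and b: "bij g" by (auto simp: SL_def)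
  have gh [simp]: "g (h x) = x" "h (g x) = x" for x
    using b by (auto simp: h_def bij_def surj_f_inv_f)
  have "h (x + y) = h (g (h x) + g (h y))" "h (s c x) = h (s c (g (h x)))" for x y c
    by simp_all
  then have "h (x + y) = h (g (h x + h y))" "h (s c x) = h (g (s c (h x)))" for x y c
    using g by (simp_all only: Vector_Spaces.linear_iff)
  then have "h (x + y) = h x + h y" "h (s c x) = s c (h x)" for x y c
    by simp_all
  then have h: "Vector_Spaces.linear s s h"
    using g by (simp add: Vector_Spaces.linear_iff)
  have "multilinear s (*) p q (\<lambda>vs \<phi>s. \<beta> (map g vs) (map (\<lambda>\<phi>. \<phi> \<circ> h) \<phi>s)) \<longleftrightarrow> multilinear s (*) p q \<beta>"
    for \<beta> :: "'a list \<Rightarrow> ('a \<Rightarrow> complex) list \<Rightarrow> complex"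
    using multilinear_compose_act[OF g h, of "(*)" p q \<beta>]
      multilinear_compose_act[OF h g, of "(*)" p q "\<lambda>vs \<phi>s. \<beta> (map g vs) (map (\<lambda>\<phi>. \<phi> \<circ> h) \<phi>s)"]
    by (auto simp: comp_def cong: map_cong)
  then show ?thesis
    unfolding tensor_act_def pure_tensor_def h_def[symmetric] by auto
qed

definition SL_invariants ::
    "(complex \<Rightarrow> 'v::ab_group_add \<Rightarrow> 'v) \<Rightarrow> nat \<Rightarrow> nat \<Rightarrow> 'v tensor set" where
  "SL_invariants s p q = {t \<in> tensor_space s p q. \<forall>g \<in> SL s. tensor_act g t = t}"

definition is_partition :: "nat \<Rightarrow> nat list \<Rightarrow> bool" where
  "is_partition n \<mu> \<longleftrightarrow> sorted_wrt (\<ge>) \<mu> \<and> (\<forall>x \<in> set \<mu>. 0 < x) \<and> sum_list \<mu> = n"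

definition add_columns :: "nat \<Rightarrow> nat \<Rightarrow> nat list \<Rightarrow> nat list" where
  "add_columns k m \<mu> = map (\<lambda>x. x + m) (\<mu> @ replicate (k - length \<mu>) 0)"

text \<open>Shapes are lists of row lengths, in which trailing zeros are allowed.\<close>

definition cells :: "nat list \<Rightarrow> (nat \<times> nat) set" where
  "cells \<mu> = {(i, j). i < length \<mu> \<and> j < \<mu> ! i}"

definition SYT :: "nat list \<Rightarrow> (nat \<times> nat \<Rightarrow> nat) set" where
  "SYT \<mu> = {T \<in> extensional (cells \<mu>).
     bij_betw T (cells \<mu>) {1..sum_list \<mu>} \<and>
     (\<forall>i j j'. (i, j) \<in> cells \<mu> \<and> (i, j') \<in> cells \<mu> \<and> j < j' \<longrightarrow> T (i, j) < T (i, j')) \<and>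
     (\<forall>i i' j. (i, j) \<in> cells \<mu> \<and> (i', j) \<in> cells \<mu> \<and> i < i' \<longrightarrow> T (i, j) < T (i', j))}"

lemma finite_partitions: "finite {\<mu>. is_partition n \<mu> \<and> length \<mu> \<le> k}"
proof (rule finite_subset)
  show "{\<mu>. is_partition n \<mu> \<and> length \<mu> \<le> k} \<subseteq> {\<mu>. set \<mu> \<subseteq> {..n} \<and> length \<mu> \<le> k}"
    using member_le_sum_list by (fastforce simp: is_partition_def)
qed (rule finite_lists_length_le, simp)

lemma finite_SYT: "finite (SYT \<mu>)"
proof (rule finite_subset)
  have "cells \<mu> = (SIGMA i:{..<length \<mu>}. {..<\<mu> ! i})" by (auto simp: cells_def)
  then show "finite (cells \<mu> \<rightarrow>\<^sub>E {1..sum_list \<mu>})" by (auto intro!: finite_PiE)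
  show "SYT \<mu> \<subseteq> cells \<mu> \<rightarrow>\<^sub>E {1..sum_list \<mu>}"
    by (auto simp: SYT_def bij_betw_def PiE_def)
qed

end

theory Submission
  imports Defs
begin

text \<open>
  A basis of \<open>V\<close> turns the mixed tensors into the functions on words of length \<open>q + p\<close> over the
  alphabet \<open>{0..<k}\<close>. An invariant under \<open>SL(V)\<close> is a vector that the off-diagonal matrix units of
  the Lie algebra kill and on which the diagonal ones act by one common scalar. The sum of the
  diagonal matrix units acts on the mixed tensors as \<open>p - q\<close>, so this scalar is \<open>c\<close> with
  \<open>p - q = c k\<close> and \<open>\<bar>c\<bar> = m\<close>. It follows that the invariants are exactly the highest weight
  vectors of the constant weight \<open>(c, \<dots>, c)\<close>. One half of this is the observation that a transvection
  \<open>I + t E\<^sub>a\<^sub>b\<close> acts as the exponential of \<open>t E\<^sub>a\<^sub>b\<close> together with the fact that transvections generate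
  \<open>SL\<close> (row reduction); the other half is that raising operators which kill a vector of constant
  weight force the lowering operators to kill it as well, because raising and lowering operators are
  adjoint for the standard Hermitian form.

  The dimension of a space of highest weight vectors is found one tensor factor at a time. For a
  dominant weight \<open>\<omega>\<close>, the dimension for \<open>M \<otimes> V\<close> at \<open>\<omega>\<close> is the sum over \<open>j\<close> of the dimensions
  for \<open>M\<close> at \<open>\<omega> - \<epsilon>\<^sub>j\<close>, and the dimension for \<open>M \<otimes> V*\<close> is the sum of those at \<open>\<omega> + \<epsilon>\<^sub>j\<close>. There are no
  highest weight vectors of a weight that is not dominant, since the squared norm of a lowered vector
  would be negative. In the rule for \<open>V\<close>, the last nonzero component of a highest weight vector
  \<open>\<Sum>i. m\<^sub>i \<otimes> e\<^sub>i\<close> is a highest weight vector of \<open>M\<close>, which bounds the dimension by the sum. Equality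
  needs every highest weight vector of \<open>M\<close> to occur as such a last component; this is \<open>gl_lift\<close>,
  where the other components are written down by an explicit recursion. Its denominators are the
  differences of the numbers \<open>\<omega>\<^sub>i - i\<close>, which are distinct because \<open>\<omega>\<close> is dominant. The rule for \<open>V*\<close>
  follows by an automorphism of the Lie algebra that exchanges \<open>V\<close> and \<open>V*\<close>.

  Hence the dimension of the invariants is the number of walks from \<open>0\<close> to \<open>(c, \<dots>, c)\<close> inside the
  dominant chamber that make \<open>p\<close> steps up followed by \<open>q\<close> steps down. Such a walk passes after \<open>p\<close> steps
  through a partition \<open>\<nu>\<close> of \<open>p\<close>. The first part of the walk is a standard tableau of shape \<open>\<nu>\<close>; the
  second part, read backwards and shifted by \<open>c\<close>, is a standard tableau of shape \<open>\<nu> - c\<^sup>k\<close>. For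
  \<open>c = m\<close> one puts \<open>\<nu> = \<mu> + m\<^sup>k\<close>, for \<open>c = - m\<close> one puts \<open>\<nu> = \<mu>\<close>, and either way the pairs
  are those in the formula.
\<close>

section \<open>Dimensions of spaces of functions\<close>

interpretation FS: vector_space fun_scale
  by (rule vector_space_fun_scale)

lemma fun_scale_apply [simp]: "fun_scale c f x = c * f x"
  by (simp add: fun_scale_def)

text \<open>
  The ambient function spaces have infinite dimension, so finiteness is part of the notion. The
  condition on the span makes \<open>S\<close> a subspace.
\<close>

definition has_dim :: "('a \<Rightarrow> complex) set \<Rightarrow> nat \<Rightarrow> bool" where
  "has_dim S n \<longleftrightarrow> (\<exists>B. finite B \<and> card B = n \<and> FS.independent B \<and> FS.span B = S)"

lemma has_dim_dim: "has_dim S n \<Longrightarrow> FS.dim S = n"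
  unfolding has_dim_def by (metis FS.dim_eq_card FS.span_span)

lemma has_dim_zero: "has_dim {0} 0"
  unfolding has_dim_def by (intro exI[of _ "{}"]) (auto simp: FS.independent_empty)

lemma has_dim_line: "v \<noteq> 0 \<Longrightarrow> has_dim {fun_scale c v |c. True} 1"
  unfolding has_dim_def
  by (intro exI[of _ "{v}"]) (auto simp: FS.span_singleton)

text \<open>
  Rank and nullity, with existence of finite bases as part of the conclusion. All dimension counts
  below are applications of this fact; with kernel \<open>{0}\<close> it transports a dimension along an
  injective map.
\<close>

lemma has_dim_extension:
  fixes f :: "('a \<Rightarrow> complex) \<Rightarrow> ('b \<Rightarrow> complex)"
  assumes f: "Vector_Spaces.linear fun_scale fun_scale f" and S: "FS.subspace S"
    and image: "has_dim (f ` S) a" and kernel: "has_dim {x \<in> S. f x = 0} b"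
  shows "has_dim S (a + b)"
proof -
  interpret f: Vector_Spaces.linear fun_scale fun_scale f by (rule f)
  from image obtain B where B: "finite B" "card B = a" "FS.independent B" "FS.span B = f ` S"
    by (auto simp: has_dim_def)
  from kernel obtain C where C: "finite C" "card C = b" "FS.independent C"
      "FS.span C = {x \<in> S. f x = 0}"
    by (auto simp: has_dim_def)
  have "\<forall>y\<in>B. \<exists>x. x \<in> S \<and> f x = y"
    using B(4) FS.span_base[of _ B] by (metis (no_types, lifting) imageE)
  then obtain g where g: "\<And>y. y \<in> B \<Longrightarrow> g y \<in> S \<and> f (g y) = y"
    using bchoice[of B "\<lambda>y x. x \<in> S \<and> f x = y"] by blast
  have inj: "inj_on g B" using g by (metis inj_onI)
  have fC: "f x = 0" if "x \<in> FS.span C" for x using that C(4) by auto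
  have disj: "g ` B \<inter> C = {}"
  proof (intro equals0I)
    fix x assume "x \<in> g ` B \<inter> C"
    then obtain y where y: "y \<in> B" "x = g y" and "x \<in> C" by auto
    then have "y = 0" using g[of y] fC[of x] FS.span_base[of x C] by auto
    with y B(3) show False using FS.dependent_zero by blast
  qed
  have ind: "FS.independent (g ` B \<union> C)"
  proof (rule FS.independent_if_scalars_zero)
    show "finite (g ` B \<union> C)" using B C by auto
    fix u x assume u: "(\<Sum>x\<in>g ` B \<union> C. fun_scale (u x) x) = 0" and x: "x \<in> g ` B \<union> C"
    have s: "(\<Sum>x\<in>g ` B \<union> C. fun_scale (u x) x) =
        (\<Sum>y\<in>B. fun_scale (u (g y)) (g y)) + (\<Sum>x\<in>C. fun_scale (u x) x)"
      using B C disj inj by (simp add: sum.union_disjoint sum.reindex)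
    have "f (\<Sum>x\<in>g ` B \<union> C. fun_scale (u x) x) = (\<Sum>y\<in>B. fun_scale (u (g y)) y)"
      using g fC[OF FS.span_base] by (simp add: s f.add f.sum f.scale)
    then have "(\<Sum>y\<in>B. fun_scale (u (g y)) y) = 0" by (simp only: u f.zero)
    then have 1: "\<forall>y\<in>B. u (g y) = 0"
      using B(1,3) FS.dependent_finite[OF B(1)] by auto
    with u have "(\<Sum>x\<in>C. fun_scale (u x) x) = 0" by (simp add: s)
    then have "\<forall>y\<in>C. u y = 0"
      using FS.dependent_finite[OF C(1)] C(3) by auto
    with 1 x show "u x = 0" by auto
  qed
  have span: "FS.span (g ` B \<union> C) = S"
  proof (intro equalityI subsetI)
    fix x assume "x \<in> FS.span (g ` B \<union> C)"
    moreover have "g ` B \<union> C \<subseteq> S" using g C(4) FS.span_base[of _ C] by auto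
    ultimately show "x \<in> S" using FS.span_minimal[OF _ S] by blast
  next
    fix x assume x: "x \<in> S"
    then have "f x \<in> FS.span B" using B(4) by auto
    then obtain u where u: "f x = (\<Sum>y\<in>B. fun_scale (u y) y)"
      using FS.span_finite[OF B(1)] by auto
    define z where "z = (\<Sum>y\<in>B. fun_scale (u y) (g y))"
    have zg: "z \<in> FS.span (g ` B)" unfolding z_def
      by (intro FS.span_sum FS.span_scale FS.span_base) auto
    have zS: "z \<in> S" unfolding z_def
      using g by (intro FS.subspace_sum[OF S] FS.subspace_scale[OF S]) auto
    have "f z = f x" using g by (simp add: z_def f.sum f.scale u)
    then have "x - z \<in> FS.span C"
      using C(4) x zS FS.subspace_diff[OF S] by (simp add: f.diff)
    moreover have "x = z + (x - z)" by simp
    ultimately show "x \<in> FS.span (g ` B \<union> C)"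
      using zg FS.span_mono[of "g ` B" "g ` B \<union> C"] FS.span_mono[of C "g ` B \<union> C"]
      by (metis FS.span_add Un_upper1 Un_upper2 subsetD)
  qed
  show ?thesis unfolding has_dim_def
    using ind span B C disj inj by (intro exI[of _ "g ` B \<union> C"]) (simp add: card_Un_disjoint card_image)
qed

section \<open>The Lie algebra acting on functions on words\<close>

text \<open>
  The matrix unit \<open>E\<^sub>a\<^sub>b\<close> of \<open>gl\<^sub>k\<close> on the tensors whose factors are \<open>V\<close> (entry \<open>True\<close> of \<open>sg\<close>) and
  \<open>V*\<close> (entry \<open>False\<close>). A tensor is the function of its coordinates; the first letter of a word belongs
  to the first factor. On \<open>V\<close> the matrix unit sends \<open>e\<^sub>b\<close> to \<open>e\<^sub>a\<close>, so the coordinate at \<open>a\<close> of the image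
  is the coordinate at \<open>b\<close>; on \<open>V*\<close> it acts by the negative transpose.
\<close>

primrec gl_act :: "bool list \<Rightarrow> nat \<Rightarrow> nat \<Rightarrow> (nat list \<Rightarrow> complex) \<Rightarrow> nat list \<Rightarrow> complex" where
  "gl_act [] a b T = (\<lambda>w. 0)"
| "gl_act (s # sg) a b T = (\<lambda>w. case w of [] \<Rightarrow> 0 | i # u \<Rightarrow> gl_act sg a b (\<lambda>u. T (i # u)) u +
     (if s then (if i = a then T (b # u) else 0) else (if i = b then - T (a # u) else 0)))"

abbreviation slice :: "nat \<Rightarrow> (nat list \<Rightarrow> complex) \<Rightarrow> nat list \<Rightarrow> complex" where
  "slice i T \<equiv> (\<lambda>u. T (i # u))"

lemma gl_act_add: "gl_act sg a b (S + T) = gl_act sg a b S + gl_act sg a b T"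
proof (induction sg arbitrary: S T)
  case (Cons s sg)
  have "gl_act sg a b (slice i (S + T)) = gl_act sg a b (slice i S) + gl_act sg a b (slice i T)" for i
    using Cons.IH[of "slice i S" "slice i T"] by (simp add: plus_fun_def)
  then show ?case by (auto simp: fun_eq_iff split: list.split)
qed (simp add: fun_eq_iff)

lemma gl_act_scale: "gl_act sg a b (fun_scale c T) = fun_scale c (gl_act sg a b T)"
proof (induction sg arbitrary: T)
  case (Cons s sg)
  have "gl_act sg a b (slice i (fun_scale c T)) = fun_scale c (gl_act sg a b (slice i T))" for i
    using Cons.IH[of "slice i T"] by (simp add: fun_scale_def)
  then show ?case by (auto simp: fun_eq_iff algebra_simps split: list.split)
qed (simp add: fun_eq_iff)

lemma linear_gl_act: "Vector_Spaces.linear fun_scale fun_scale (gl_act sg a b)"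
  by (simp add: Vector_Spaces.linear_iff vector_space_fun_scale gl_act_add gl_act_scale)

lemma gl_act_zero [simp]: "gl_act sg a b 0 = 0"
  using gl_act_scale[of sg a b 0 0] by (simp add: fun_scale_def zero_fun_def)

lemma gl_act_uminus: "gl_act sg a b (- T) = - gl_act sg a b T"
  using gl_act_scale[of sg a b "-1" T] by (simp add: fun_scale_def fun_Compl_def)

lemma slice_gl_act: "slice i (gl_act (s # sg) a b T) = gl_act sg a b (slice i T) +
    (if s then (if i = a then slice b T else 0) else (if i = b then - slice a T else 0))"
  by (auto simp: fun_eq_iff)

lemma gl_act_E_Cons:
  "gl_act (s # sg) a b (gl_act (s # sg) c d T) (i # u) = gl_act sg a b (gl_act sg c d (slice i T)) u +
    (if s then (if i = c then gl_act sg a b (slice d T) u else 0) +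
       (if i = a then gl_act sg c d (slice b T) u + (if b = c then T (d # u) else 0) else 0)
     else (if i = d then - gl_act sg a b (slice c T) u else 0) -
       (if i = b then gl_act sg c d (slice a T) u - (if a = d then T (c # u) else 0) else 0))"
proof -
  have "slice i (gl_act (s # sg) a b (gl_act (s # sg) c d T)) = gl_act sg a b (gl_act sg c d (slice i T)) +
    (if s then (if i = c then gl_act sg a b (slice d T) else 0) +
       (if i = a then gl_act sg c d (slice b T) + (if b = c then slice d T else 0) else 0)
     else (if i = d then - gl_act sg a b (slice c T) else 0) -
       (if i = b then gl_act sg c d (slice a T) - (if a = d then slice c T else 0) else 0))"
    unfolding slice_gl_act by (cases s) (simp_all add: gl_act_add gl_act_uminus algebra_simps)
  from fun_cong[OF this, of u] show ?thesis
    by (cases s) (auto split: if_splits)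
qed

text \<open>
  Both \<open>V\<close> and \<open>V*\<close> satisfy the relations of \<open>gl\<^sub>k\<close>, and the action on a tensor product is by the
  Leibniz rule, which preserves them.
\<close>

lemma gl_act_commutator:
  "gl_act sg a b (gl_act sg c d T) - gl_act sg c d (gl_act sg a b T) =
     (if b = c then gl_act sg a d T else 0) - (if d = a then gl_act sg c b T else 0)"
proof (induction sg arbitrary: T)
  case (Cons s sg)
  have IH: "gl_act sg a b (gl_act sg c d T) u = gl_act sg c d (gl_act sg a b T) u +
     (if b = c then gl_act sg a d T u else 0) - (if d = a then gl_act sg c b T u else 0)" for u T
    using fun_cong[OF Cons.IH[of T], of u] by (auto simp: algebra_simps)
  show ?case
  proof
    fix w show "(gl_act (s # sg) a b (gl_act (s # sg) c d T) - gl_act (s # sg) c d (gl_act (s # sg) a b T)) w =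
     ((if b = c then gl_act (s # sg) a d T else 0) - (if d = a then gl_act (s # sg) c b T else 0)) w"
    proof (cases w)
      case (Cons i u)
      show ?thesis unfolding Cons fun_diff_def gl_act_E_Cons
        by (cases s) (auto simp: IH)
    qed auto
  qed
qed (simp add: fun_eq_iff)

definition words :: "nat \<Rightarrow> nat \<Rightarrow> nat list set" where
  "words k n = {w. length w = n \<and> set w \<subseteq> {..<k}}"

lemma finite_words: "finite (words k n)"
  unfolding words_def using finite_lists_length_eq[of "{..<k}" n] by (simp add: conj_commute)

lemma words_0 [simp]: "words k 0 = {[]}"
  by (auto simp: words_def)

lemma words_Suc: "words k (Suc n) = (\<lambda>(i, u). i # u) ` ({..<k} \<times> words k n)"
  by (force simp: words_def length_Suc_conv)

lemma sum_words_Suc: "(\<Sum>w\<in>words k (Suc n). f w) = (\<Sum>i<k. \<Sum>u\<in>words k n. f (i # u))"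
proof -
  have "inj_on (\<lambda>(i, u). i # u) ({..<k} \<times> words k n)" by (auto simp: inj_on_def)
  from sum.reindex[OF this, of f] show ?thesis
    by (simp add: words_Suc sum.cartesian_product comp_def case_prod_unfold)
qed

text \<open>
  The standard Hermitian form. Its positivity excludes weights that are not dominant and kills lowered
  vectors of constant weight.
\<close>

definition ip :: "nat \<Rightarrow> nat \<Rightarrow> (nat list \<Rightarrow> complex) \<Rightarrow> (nat list \<Rightarrow> complex) \<Rightarrow> complex" where
  "ip k n S T = (\<Sum>w\<in>words k n. S w * cnj (T w))"

lemma ip_Suc: "ip k (Suc n) S T = (\<Sum>i<k. ip k n (slice i S) (slice i T))"
  by (simp add: ip_def sum_words_Suc)

lemma ip_add_left: "ip k n (S + S') T = ip k n S T + ip k n S' T"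
  by (simp add: ip_def sum.distrib algebra_simps)

lemma ip_add_right: "ip k n S (T + T') = ip k n S T + ip k n S T'"
  by (simp add: ip_def sum.distrib algebra_simps)

lemma ip_minus: "ip k n (- S) T = - ip k n S T" "ip k n S (- T) = - ip k n S T"
  by (simp_all add: ip_def sum_negf)

lemma ip_zero: "ip k n 0 T = 0" "ip k n S 0 = 0"
  by (simp_all add: ip_def)

lemma ip_scale_left: "ip k n (fun_scale c S) T = c * ip k n S T"
  by (simp add: ip_def sum_distrib_left algebra_simps)

text \<open>
  Matrix units are real, so their adjoints are their transposes; this passes from each factor
  to the tensor product.
\<close>

lemma gl_act_adjoint:
  assumes "a < k" "b < k"
  shows "ip k (length sg) (gl_act sg a b S) T = ip k (length sg) S (gl_act sg b a T)"
proof (induction sg arbitrary: S T)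
  case (Cons s sg)
  have if_l: "ip k (length sg) (if P then X else 0) Y = (if P then ip k (length sg) X Y else 0)"
    and if_r: "ip k (length sg) Y (if P then X else 0) = (if P then ip k (length sg) Y X else 0)" for P X Y
    by (auto simp: ip_zero)
  show ?case using assms
    by (cases s) (simp_all only: list.size(4) add_0_right add_Suc_right slice_gl_act ip_Suc ip_add_left ip_add_right Cons.IH
        sum.distrib if_True if_False ip_minus if_l if_r sum.delta finite_lessThan lessThan_iff)
qed (simp add: ip_def)

lemma ip_self: "ip k n T T = of_real (\<Sum>w\<in>words k n. (cmod (T w))\<^sup>2)"
  by (simp add: ip_def complex_norm_square del: of_real_power)

definition word_funs :: "nat \<Rightarrow> nat \<Rightarrow> (nat list \<Rightarrow> complex) set" where
  "word_funs k n = {T. \<forall>w. w \<notin> words k n \<longrightarrow> T w = 0}"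

lemma subspace_word_funs: "FS.subspace (word_funs k n)"
  by (auto simp: FS.subspace_def word_funs_def)

lemma ip_self_eq_0:
  assumes "T \<in> word_funs k n" "ip k n T T = 0"
  shows "T = 0"
proof -
  from assms(2) have "(\<Sum>w\<in>words k n. (cmod (T w))\<^sup>2) = 0" unfolding ip_self of_real_eq_0_iff .
  then have "\<forall>w\<in>words k n. (cmod (T w))\<^sup>2 = 0"
    by (subst (asm) sum_nonneg_eq_0_iff) (auto simp: finite_words)
  with assms(1) show ?thesis by (auto simp: word_funs_def fun_eq_iff)
qed

lemma word_funs_Suc: "T \<in> word_funs k (Suc n) \<longleftrightarrow>
    T [] = 0 \<and> (\<forall>i<k. slice i T \<in> word_funs k n) \<and> (\<forall>i\<ge>k. slice i T = 0)"
proof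
  assume "T \<in> word_funs k (Suc n)"
  then show "T [] = 0 \<and> (\<forall>i<k. slice i T \<in> word_funs k n) \<and> (\<forall>i\<ge>k. slice i T = 0)"
    by (auto simp: word_funs_def words_def fun_eq_iff)
next
  assume R: "T [] = 0 \<and> (\<forall>i<k. slice i T \<in> word_funs k n) \<and> (\<forall>i\<ge>k. slice i T = 0)"
  show "T \<in> word_funs k (Suc n)"
    unfolding word_funs_def
  proof (intro CollectI allI impI)
    fix w assume w: "w \<notin> words k (Suc n)"
    show "T w = 0"
    proof (cases w)
      case (Cons i u)
      show ?thesis
      proof (cases "i < k")
        case True
        then have "u \<notin> words k n" using w Cons by (auto simp: words_def)
        then show ?thesis using R True Cons by (auto simp: word_funs_def)
      next
        case False
        then have "slice i T u = 0" using R by (metis not_less zero_fun_apply)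
        then show ?thesis using Cons by simp
      qed
    qed (use R in simp)
  qed
qed

lemma gl_act_word_funs:
  assumes "a < k" "b < k" "T \<in> word_funs k (length sg)"
  shows "gl_act sg a b T \<in> word_funs k (length sg)"
  using assms(3)
proof (induction sg arbitrary: T)
  case (Cons s sg)
  note sub = subspace_word_funs[of k "length sg"]
  have "slice i T \<in> word_funs k (length sg) \<and> (k \<le> i \<longrightarrow> slice i T = 0)" for i
    using Cons.prems FS.subspace_0[OF sub] by (cases "i < k") (auto simp: word_funs_Suc not_less)
  moreover from this have "gl_act sg a b (slice i T) \<in> word_funs k (length sg)" for i
    by (intro Cons.IH) auto
  ultimately have "slice i (gl_act (s # sg) a b T) \<in> word_funs k (length sg) \<and>
      (k \<le> i \<longrightarrow> slice i (gl_act (s # sg) a b T) = 0)" for i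
    unfolding slice_gl_act using assms(1,2)
    by (auto intro!: FS.subspace_add[OF sub] FS.subspace_neg[OF sub] FS.subspace_0[OF sub] FS.subspace_diff[OF sub]
      simp del: plus_fun_apply)
  then show ?case by (simp only: list.size add_0_right add_Suc_right word_funs_Suc) (simp add: zero_fun_def)
qed (simp add: word_funs_def)

section \<open>Lifting highest weight vectors\<close>

text \<open>
  Let \<open>w\<close> be a highest weight vector of weight \<open>\<omega> - \<epsilon>\<^sub>j\<close>. The lemma extends \<open>w\<close> to a highest weight
  vector \<open>\<Sum>i. m\<^sub>i \<otimes> e\<^sub>i\<close> of weight \<open>\<omega>\<close> with \<open>m\<^sub>j = w\<close> and nothing above \<open>j\<close>; the two conclusions
  on \<open>E\<close> say that this sum is killed by the raising operators and has the right weight. The operator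
  \<open>\<Sum>a b. E\<^sub>a\<^sub>b \<otimes> E\<^sub>b\<^sub>a\<close>, the mixed part of the Casimir element, commutes with the Lie algebra and acts
  on such a vector by the scalar \<open>\<omega>\<^sub>j - j - 1\<close>. Comparing coefficients of \<open>e\<^sub>b\<close> gives
  \<open>d\<^sub>b m\<^sub>b = - (\<Sum>b < i \<le> j. E\<^sub>i\<^sub>b m\<^sub>i)\<close> with \<open>d\<^sub>b = (\<omega>\<^sub>b - b) - (\<omega>\<^sub>j - j)\<close>, and this recursion, which runs
  downwards from \<open>j\<close>, is used as the definition of \<open>m\<close>. The action is a parameter because the
  lemma is applied to \<open>V\<close> and, through a twist of the action, to \<open>V*\<close>.
\<close>

lemma gl_lift:
  fixes E :: "nat \<Rightarrow> nat \<Rightarrow> ('x \<Rightarrow> complex) \<Rightarrow> 'x \<Rightarrow> complex" and \<omega> :: "nat \<Rightarrow> complex"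
  assumes lin: "\<And>a b. Vector_Spaces.linear fun_scale fun_scale (E a b)"
    and comm: "\<And>a b c d x. a < k \<Longrightarrow> b < k \<Longrightarrow> c < k \<Longrightarrow> d < k \<Longrightarrow>
      E a b (E c d x) = E c d (E a b x) + (if b = c then E a d x else 0) - (if d = a then E c b x else 0)"
    and M: "FS.subspace M" and inv: "\<And>a b x. a < k \<Longrightarrow> b < k \<Longrightarrow> x \<in> M \<Longrightarrow> E a b x \<in> M" and wM: "w \<in> M"
    and j: "j < k" and l: "\<And>b. b < j \<Longrightarrow> \<omega> b - of_nat b \<noteq> \<omega> j - of_nat j"
    and w: "\<And>a b. a < b \<Longrightarrow> b < k \<Longrightarrow> E a b w = 0"
    and wt: "\<And>a. a < k \<Longrightarrow> E a a w = fun_scale (\<omega> a - (if a = j then 1 else 0)) w"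
  obtains m where "m j = w" and "\<And>i. i > j \<Longrightarrow> m i = 0"
    and "\<And>i a b. i < k \<Longrightarrow> a < b \<Longrightarrow> b < k \<Longrightarrow> E a b (m i) = (if i = a then - m b else 0)"
    and "\<And>i a. i < k \<Longrightarrow> a < k \<Longrightarrow> E a a (m i) = fun_scale (\<omega> a - (if a = i then 1 else 0)) (m i)"
    and "\<And>i. m i \<in> M"
proof -
  interpret L: Vector_Spaces.linear fun_scale fun_scale "E a b" for a b by (rule lin)
  define d where "d b = (\<omega> b - of_nat b) - (\<omega> j - of_nat j)" for b
  have d: "d b \<noteq> 0" if "b < j" for b using l[OF that] by (simp add: d_def)
  define P where "P m b r \<longleftrightarrow> r = (if b = j then w else if b > j then 0
      else fun_scale (- (1 / d b)) (\<Sum>i\<in>{b<..j}. E i b (m i)))"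
    for m :: "nat \<Rightarrow> 'x \<Rightarrow> complex" and b r
  \<comment> \<open>Recursion along the descending order on \<open>{..j}\<close>: the value at \<open>b\<close> refers to larger indices only.\<close>
  have "\<exists>m. \<forall>b. P m b (m b)"
  proof (rule dependent_wf_choice)
    show "wf {(i, b). b < i \<and> i \<le> j}"
      by (rule wf_subset[OF wf_measure[of "\<lambda>b. j - b"]]) auto
  next
    fix f g :: "nat \<Rightarrow> 'x \<Rightarrow> complex" and b r
    assume "\<And>z. (z, b) \<in> {(i, b). b < i \<and> i \<le> j} \<Longrightarrow> f z = g z"
    then have "(\<Sum>i\<in>{b<..j}. E i b (f i)) = (\<Sum>i\<in>{b<..j}. E i b (g i))"
      by (intro sum.cong) auto
    then show "P f b r = P g b r" by (simp add: P_def)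
  qed (auto simp: P_def)
  then obtain m where "P m b (m b)" for b by blast
  then have mj: "m j = w" and mbig: "\<And>i. i > j \<Longrightarrow> m i = 0"
    and mb: "\<And>b. b < j \<Longrightarrow> m b = fun_scale (- (1 / d b)) (\<Sum>i\<in>{b<..j}. E i b (m i))"
    unfolding P_def by (metis less_irrefl, metis less_irrefl less_not_sym, metis less_irrefl less_not_sym)
  have wtm: "E a a (m i) = fun_scale (\<omega> a - (if a = i then 1 else 0)) (m i)" if a: "a < k" for a i
  proof (induction "j - i" arbitrary: i rule: less_induct)
    case less
    consider "i = j" | "i > j" | "i < j" by linarith
    then show ?case
    proof cases
      case 3
      have "E a a (E t i (m t)) = fun_scale (\<omega> a - (if a = i then 1 else 0)) (E t i (m t))"
        if t: "t \<in> {i<..j}" for t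
      proof -
        have "E a a (m t) = fun_scale (\<omega> a - (if a = t then 1 else 0)) (m t)"
          using t 3 by (intro less) auto
        then have "E t i (E a a (m t)) = fun_scale (\<omega> a - (if a = t then 1 else 0)) (E t i (m t))"
          by (simp only: L.scale)
        then show ?thesis
          using t 3 a j comm[of a a t i "m t"] by (auto simp: fun_eq_iff algebra_simps)
      qed
      then have s: "E a a (\<Sum>t\<in>{i<..j}. E t i (m t)) =
          fun_scale (\<omega> a - (if a = i then 1 else 0)) (\<Sum>t\<in>{i<..j}. E t i (m t))"
        unfolding L.sum FS.scale_sum_right by (rule sum.cong[OF refl])
      show ?thesis
        unfolding mb[OF 3] L.scale s by (rule FS.scale_left_commute)
    qed (use wt[OF a] mj mbig in \<open>auto simp: L.zero\<close>)
  qed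
  have dm: "(\<Sum>i\<in>{b<..j}. E i b (m i)) = fun_scale (- d b) (m b)" if "b \<le> j" for b
  proof (cases "b = j")
    case False
    with that d mb[of b] show ?thesis by simp
  qed (simp add: d_def)
  \<comment> \<open>Commuting \<open>E\<^sub>a\<^sub>b\<close> past \<open>E\<^sub>t\<^sub>i\<close> in the recursion leaves three sums; the cases are distinguished by which of them survive.\<close>
  have hw: "E a b (m i) = (if i = a then - m b else 0)" if ab: "a < b" "b < k" for a b i
    using ab
  proof (induction "j - i" arbitrary: i a b rule: less_induct)
    case less
    consider "i = j" | "i > j" | "i < j" by linarith
    then show ?case
    proof cases
      case 3
      have IH: "E a b (m t) = (if t = a then - m b else 0)"
        if "t \<in> {i<..j}" "a < b" "b < k" for t a b
        using less(1)[of t a b] that 3 by auto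
      have "E a b (E t i (m t)) = (if t = a then - E a i (m b) else 0) +
          (if t = b then E a i (m b) else 0) - (if i = a then E t b (m t) else 0)"
        if t: "t \<in> {i<..j}" for t
        using IH[OF t less.prems] t less.prems j by (auto simp: comm L.zero L.neg)
      then have "(\<Sum>t\<in>{i<..j}. E a b (E t i (m t))) =
          (if a \<in> {i<..j} then - E a i (m b) else 0) + (if b \<in> {i<..j} then E a i (m b) else 0) -
          (if i = a then \<Sum>t\<in>{i<..j}. E t b (m t) else 0)"
        by (simp add: sum.distrib sum_subtractf sum.delta)
      also have "\<dots> = (if i = a then fun_scale (d i) (m b) else 0)"
      proof (cases "i = a")
        case False
        show ?thesis
        proof (cases "b \<in> {i<..j} \<and> a < i")
          case True
          with IH[of b a i] less.prems show ?thesis by auto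
        next
          case b: False
          show ?thesis
          proof (cases "b \<le> j")
            case True
            with False b less.prems show ?thesis by auto
          next
            case False
            with \<open>i \<noteq> a\<close> show ?thesis by (auto simp: mbig L.zero)
          qed
        qed
      next
        case True
        show ?thesis
        proof (cases "b \<le> j")
          case b: True
          \<comment> \<open>The terms below \<open>b\<close> are raised to multiples of \<open>m\<^sub>b\<close>, the term at \<open>b\<close> is a weight, and those above form the recursion for \<open>m\<^sub>b\<close>.\<close>
          have split: "{i<..j} = {i<..<b} \<union> ({b} \<union> {b<..j})" using b True less.prems by auto
          have "(\<Sum>t\<in>{i<..j}. E t b (m t)) =
              (\<Sum>t\<in>{i<..<b}. E t b (m t)) + (E b b (m b) + (\<Sum>t\<in>{b<..j}. E t b (m t)))"
            unfolding split by (subst sum.union_disjoint; (auto)?)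
          also have "(\<Sum>t\<in>{i<..<b}. E t b (m t)) = (\<Sum>t\<in>{i<..<b}. - m b)"
            using b less.prems by (intro sum.cong refl) (simp add: IH)
          also have "\<dots> = fun_scale (- of_nat (b - Suc i)) (m b)"
            by (simp add: fun_eq_iff)
          finally show ?thesis
            using True b less.prems wtm[of b b] wtm[of a b] dm[OF b]
            by (simp add: fun_eq_iff d_def algebra_simps of_nat_diff)
        next
          case False
          have "(\<Sum>t\<in>{i<..j}. E t b (m t)) = (\<Sum>t\<in>{i<..j}. 0)"
            using False less.prems by (intro sum.cong refl) (simp add: IH mbig)
          then show ?thesis using False True by (simp add: mbig)
        qed
      qed
      finally have sum: "(\<Sum>t\<in>{i<..j}. E a b (E t i (m t))) = \<dots>" .
      show ?thesis
        unfolding mb[OF 3] L.scale L.sum sum using d[OF 3] by auto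
    qed (use w[OF less.prems] mj mbig less.prems in \<open>auto simp: L.zero\<close>)
  qed
  have "m i \<in> M" for i
  proof (induction "j - i" arbitrary: i rule: less_induct)
    case less
    consider "i = j" | "i > j" | "i < j" by linarith
    then show ?case
    proof cases
      case 3
      then show ?thesis using j unfolding mb[OF 3]
        by (intro FS.subspace_scale[OF M] FS.subspace_sum[OF M] inv less) auto
    qed (use mj mbig wM FS.subspace_0[OF M] in auto)
  qed
  then show thesis using that[of m] mj mbig wtm hw by blast
qed

section \<open>The dimension of a highest weight space\<close>

text \<open>
  Highest weight vectors. The raising operators are the matrix units \<open>E\<^sub>a\<^sub>b\<close> with \<open>a < b\<close>.
\<close>

definition HW :: "nat \<Rightarrow> bool list \<Rightarrow> (nat \<Rightarrow> int) \<Rightarrow> (nat list \<Rightarrow> complex) set" where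
  "HW k sg \<omega> = {T \<in> word_funs k (length sg). (\<forall>b<k. \<forall>a<b. gl_act sg a b T = 0) \<and>
     (\<forall>a<k. gl_act sg a a T = fun_scale (of_int (\<omega> a)) T)}"

definition dominant :: "nat \<Rightarrow> (nat \<Rightarrow> int) \<Rightarrow> bool" where
  "dominant k \<omega> \<longleftrightarrow> (\<forall>b<k. \<forall>a<b. \<omega> b \<le> \<omega> a)"

lemma subspace_HW: "FS.subspace (HW k sg \<omega>)"
proof -
  interpret L: Vector_Spaces.linear fun_scale fun_scale "gl_act sg a b" for a b by (rule linear_gl_act)
  show ?thesis using subspace_word_funs[of k "length sg"]
    by (auto simp: FS.subspace_def HW_def L.add L.scale L.zero FS.scale_right_distrib FS.scale_left_commute
      simp del: plus_fun_apply)
qed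

text \<open>
  Moving one lowering operator to the other side of the form turns it into a raising operator, and
  the commutator of the two is a difference of diagonal matrix units.
\<close>

lemma norm_lowering:
  assumes T: "T \<in> HW k sg \<omega>" and ab: "a < b" "b < k"
  shows "ip k (length sg) (gl_act sg b a T) (gl_act sg b a T) = of_int (\<omega> a - \<omega> b) * ip k (length sg) T T"
proof -
  have a: "a < k" using ab by simp
  have "gl_act sg a b (gl_act sg b a T) = fun_scale (of_int (\<omega> a - \<omega> b)) T"
  proof -
    from T ab a have "gl_act sg a b T = 0" "gl_act sg a a T = fun_scale (of_int (\<omega> a)) T"
      "gl_act sg b b T = fun_scale (of_int (\<omega> b)) T" by (simp_all add: HW_def)
    with gl_act_commutator[of sg a b b a T] show ?thesis by (simp add: fun_eq_iff algebra_simps)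
  qed
  moreover have "ip k (length sg) (gl_act sg a b (gl_act sg b a T)) T = ip k (length sg) (gl_act sg b a T) (gl_act sg b a T)"
    by (rule gl_act_adjoint[OF a ab(2)])
  ultimately show ?thesis by (simp add: ip_scale_left)
qed

text \<open>
  A norm that is a negative multiple of another one forces both to vanish.
\<close>

lemma HW_not_dominant:
  assumes "\<not> dominant k \<omega>"
  shows "HW k sg \<omega> = {0}"
proof -
  from assms obtain a b where ab: "a < b" "b < k" "\<omega> a < \<omega> b" by (auto simp: dominant_def not_le)
  have "T = 0" if T: "T \<in> HW k sg \<omega>" for T
  proof -
    define r where "r S = (\<Sum>w\<in>words k (length sg). (cmod (S w))\<^sup>2)" for S
    have r: "r S \<ge> 0" for S by (auto simp: r_def sum_nonneg)
    have "complex_of_real (r (gl_act sg b a T)) = of_real (of_int (\<omega> a - \<omega> b) * r T)"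
      using norm_lowering[OF T ab(1,2)] by (simp add: ip_self r_def)
    then have "r (gl_act sg b a T) = of_int (\<omega> a - \<omega> b) * r T" by (simp only: of_real_eq_iff)
    moreover have "real_of_int (\<omega> a - \<omega> b) < 0" using ab by simp
    ultimately have "r T = 0" using r[of T] r[of "gl_act sg b a T"] mult_neg_pos[of "real_of_int (\<omega> a - \<omega> b)" "r T"]
      by force
    then have "ip k (length sg) T T = 0" by (simp add: ip_self r_def)
    with T show ?thesis by (auto simp: HW_def intro: ip_self_eq_0)
  qed
  moreover have "0 \<in> HW k sg \<omega>" by (rule FS.subspace_0[OF subspace_HW])
  ultimately show ?thesis by blast
qed

lemma HW_constant_lowering:
  assumes T: "T \<in> HW k sg (\<lambda>_. c)" and "a < k" "b < k" "a \<noteq> b"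
  shows "gl_act sg a b T = 0"
proof (cases "a < b")
  case False
  then have "ip k (length sg) (gl_act sg a b T) (gl_act sg a b T) = 0"
    using norm_lowering[OF T, of b a] assms by simp
  then show ?thesis
    using assms by (intro ip_self_eq_0[of _ k "length sg"] gl_act_word_funs) (auto simp: HW_def)
qed (use assms in \<open>auto simp: HW_def\<close>)

text \<open>
  Reversing the alphabet is the way in which \<open>V*\<close> is treated like \<open>V\<close>: its basis vector \<open>e\<^sub>i\<^sup>*\<close> has weight
  \<open>- \<epsilon>\<^sub>i\<close>, so the highest weight of \<open>V*\<close> sits at the last letter.
\<close>

definition flip :: "nat \<Rightarrow> bool \<Rightarrow> nat \<Rightarrow> nat" where
  "flip k s i = (if s then i else k - 1 - i)"

definition tsign :: "bool \<Rightarrow> int" where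
  "tsign s = (if s then 1 else -1)"

text \<open>
  For a factor \<open>V*\<close>, the action composed with the automorphism \<open>E\<^sub>a\<^sub>b \<mapsto> - E\<^sub>b\<^sub>'\<^sub>a\<^sub>'\<close> of \<open>gl\<^sub>k\<close>, where the prime
  reverses the alphabet. It maps raising operators to raising operators and turns \<open>V*\<close> into \<open>V\<close>.
\<close>

definition twisted :: "nat \<Rightarrow> bool \<Rightarrow> bool list \<Rightarrow> nat \<Rightarrow> nat \<Rightarrow> (nat list \<Rightarrow> complex) \<Rightarrow> nat list \<Rightarrow> complex" where
  "twisted k s sg a b T = (if s then gl_act sg a b T else - gl_act sg (flip k s b) (flip k s a) T)"

lemma flip_less: "i < k \<Longrightarrow> flip k s i < k"
  and flip_flip: "i < k \<Longrightarrow> flip k s (flip k s i) = i"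
  and flip_eq_iff: "i < k \<Longrightarrow> j < k \<Longrightarrow> flip k s i = flip k s j \<longleftrightarrow> i = j"
  and flip_True: "flip k True i = i"
  and flip_False_less: "j < k \<Longrightarrow> i < j \<Longrightarrow> flip k False j < flip k False i"
  by (auto simp: flip_def)

lemma linear_twisted: "Vector_Spaces.linear fun_scale fun_scale (twisted k s sg a b)"
  unfolding Vector_Spaces.linear_iff twisted_def
  by (simp add: vector_space_fun_scale gl_act_add gl_act_scale)

lemma twisted_commutator:
  assumes "a < k" "b < k" "c < k" "d < k"
  shows "twisted k s sg a b (twisted k s sg c d x) = twisted k s sg c d (twisted k s sg a b x) +
     (if b = c then twisted k s sg a d x else 0) - (if d = a then twisted k s sg c b x else 0)"
proof (cases s)
  case True
  show ?thesis using gl_act_commutator[of sg a b c d x] True by (auto simp: twisted_def algebra_simps)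
next
  case False
  show ?thesis
    using gl_act_commutator[of sg "flip k s b" "flip k s a" "flip k s d" "flip k s c" x] False assms
    by (auto simp: twisted_def gl_act_uminus flip_eq_iff algebra_simps)
qed

lemma twisted_word_funs: "a < k \<Longrightarrow> b < k \<Longrightarrow> T \<in> word_funs k (length sg) \<Longrightarrow> twisted k s sg a b T \<in> word_funs k (length sg)"
  using FS.subspace_neg[OF subspace_word_funs] by (auto simp: twisted_def flip_less gl_act_word_funs)

lemma slice_twisted:
  assumes "i < k" "a < k" "b < k"
  shows "slice (flip k s i) (twisted k s (s # sg) a b T) =
    twisted k s sg a b (slice (flip k s i) T) + (if i = a then slice (flip k s b) T else 0)"
  using assms by (cases s) (auto simp: twisted_def flip_eq_iff flip_True fun_eq_iff)

lemma HW_twisted: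
  "T \<in> HW k sg \<omega> \<longleftrightarrow> T \<in> word_funs k (length sg) \<and> (\<forall>b<k. \<forall>a<b. twisted k s sg a b T = 0) \<and>
     (\<forall>a<k. twisted k s sg a a T = fun_scale (of_int (tsign s * \<omega> (flip k s a))) T)"
proof (cases s)
  case False
  have *: "(\<forall>a<k. P a) \<longleftrightarrow> (\<forall>a<k. P (flip k s a))" for P
    by (metis flip_less flip_flip)
  have "(\<forall>b<k. \<forall>a<b. gl_act sg a b T = 0) \<longleftrightarrow> (\<forall>b<k. \<forall>a<b. gl_act sg (flip k s b) (flip k s a) T = 0)"
  proof (intro iffI allI impI)
    fix a b assume R: "\<forall>b<k. \<forall>a<b. gl_act sg (flip k s b) (flip k s a) T = 0" and ab: "b < k" "a < b"
    then have "flip k s a < k" "flip k s b < flip k s a" using False by (auto simp: flip_False_less flip_less)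
    with R have "gl_act sg (flip k s (flip k s a)) (flip k s (flip k s b)) T = 0" by blast
    then show "gl_act sg a b T = 0" using ab by (simp add: flip_flip)
  next
    fix a b assume R: "\<forall>b<k. \<forall>a<b. gl_act sg a b T = 0" and ab: "b < k" "a < b"
    then have "flip k s a < k" "flip k s b < flip k s a" using False by (auto simp: flip_False_less flip_less)
    with R show "gl_act sg (flip k s b) (flip k s a) T = 0" by blast
  qed
  moreover have "(\<forall>a<k. gl_act sg a a T = fun_scale (of_int (\<omega> a)) T) \<longleftrightarrow>
      (\<forall>a<k. - gl_act sg (flip k s a) (flip k s a) T = fun_scale (of_int (tsign s * \<omega> (flip k s a))) T)"
    using False by (subst *) (auto simp: tsign_def fun_eq_iff)
  ultimately show ?thesis using False by (simp add: HW_def twisted_def)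
qed (simp add: HW_def twisted_def tsign_def flip_def)

text \<open>
  The conditions on a highest weight vector, expressed by its components. In the twisted form they read the
  same for \<open>V\<close> and \<open>V*\<close>, and they are the conclusion of \<open>gl_lift\<close>.
\<close>

lemma HW_Cons:
  "T \<in> HW k (s # sg) \<omega> \<longleftrightarrow> T \<in> word_funs k (Suc (length sg)) \<and>
     (\<forall>i<k. \<forall>b<k. \<forall>a<b. twisted k s sg a b (slice (flip k s i) T) = (if i = a then - slice (flip k s b) T else 0)) \<and>
     (\<forall>i<k. \<forall>a<k. twisted k s sg a a (slice (flip k s i) T) =
        fun_scale (of_int (tsign s * \<omega> (flip k s a)) - (if a = i then 1 else 0)) (slice (flip k s i) T))"
proof -
  have ext: "S = S' \<longleftrightarrow> (\<forall>i<k. slice (flip k s i) S = slice (flip k s i) S')"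
    if S: "S \<in> word_funs k (Suc (length sg))" and S': "S' \<in> word_funs k (Suc (length sg))" for S S'
  proof
    assume R: "\<forall>i<k. slice (flip k s i) S = slice (flip k s i) S'"
    have "slice i S = slice i S'" for i
    proof (cases "i < k")
      case True
      with R show ?thesis by (metis flip_less flip_flip)
    next
      case False
      with S S' show ?thesis by (simp add: word_funs_Suc)
    qed
    then have "S (i # u) = S' (i # u)" for i u by meson
    then show "S = S'" using S S' by (intro ext, case_tac x) (auto simp: word_funs_Suc)
  qed simp
  have Z: "0 \<in> word_funs k (Suc (length sg))" by (rule FS.subspace_0[OF subspace_word_funs])
  show ?thesis
  proof (cases "T \<in> word_funs k (Suc (length sg))")
    case True
    have tws: "twisted k s (s # sg) a b T \<in> word_funs k (Suc (length sg))" if "a < k" "b < k" for a b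
      using twisted_word_funs[of a k b T "s # sg" s] that True by simp
    have scs: "fun_scale c T \<in> word_funs k (Suc (length sg))" for c
      by (rule FS.subspace_scale[OF subspace_word_funs True])
    have 1: "twisted k s (s # sg) a b T = 0 \<longleftrightarrow>
       (\<forall>i<k. twisted k s sg a b (slice (flip k s i) T) = (if i = a then - slice (flip k s b) T else 0))"
      if "a < b" "b < k" for a b
    proof -
      have "a < k" using that by simp
      then show ?thesis
        using that unfolding ext[OF tws[OF \<open>a < k\<close> \<open>b < k\<close>] Z]
        by (auto simp: slice_twisted eq_neg_iff_add_eq_0 zero_fun_def[symmetric] simp del: plus_fun_apply)
    qed
    have 2: "twisted k s (s # sg) a a T = fun_scale c T \<longleftrightarrow>
       (\<forall>i<k. twisted k s sg a a (slice (flip k s i) T) = fun_scale (c - (if a = i then 1 else 0)) (slice (flip k s i) T))"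
      if "a < k" for a c
      unfolding ext[OF tws[OF that that] scs]
      using that by (intro all_cong) (auto simp: slice_twisted fun_eq_iff algebra_simps)
    have "(\<forall>b<k. \<forall>a<b. twisted k s (s # sg) a b T = 0) \<longleftrightarrow> (\<forall>i<k. \<forall>b<k. \<forall>a<b.
        twisted k s sg a b (slice (flip k s i) T) = (if i = a then - slice (flip k s b) T else 0))"
      using 1 by blast
    moreover have "(\<forall>a<k. twisted k s (s # sg) a a T = fun_scale (of_int (tsign s * \<omega> (flip k s a))) T) \<longleftrightarrow>
       (\<forall>i<k. \<forall>a<k. twisted k s sg a a (slice (flip k s i) T) =
        fun_scale (of_int (tsign s * \<omega> (flip k s a)) - (if a = i then 1 else 0)) (slice (flip k s i) T))"
      using 2 by blast
    ultimately show ?thesis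
      unfolding HW_twisted[of T k "s # sg" \<omega> s] by (simp only: list.size add_0_right add_Suc_right)
  next
    case False
    then have "T \<notin> HW k (s # sg) \<omega>" by (simp add: HW_def)
    with False show ?thesis by blast
  qed
qed

text \<open>
  Filter the highest weight vectors by their last nonzero component, in the reversed alphabet for \<open>V*\<close>. The graded pieces are the
  highest weight spaces of the shifted weights, since the last component is itself a highest weight
  vector and every highest weight vector occurs by \<open>gl_lift\<close>.
\<close>

lemma HW_Cons_has_dim:
  assumes dom: "dominant k \<omega>"
    and d: "\<And>j. j < k \<Longrightarrow> has_dim (HW k sg (\<omega>(flip k s j := \<omega> (flip k s j) - tsign s))) (d j)"
  shows "has_dim (HW k (s # sg) \<omega>) (\<Sum>j<k. d j)"
proof -
  define G where "G r = {T \<in> HW k (s # sg) \<omega>. \<forall>i<k. r \<le> i \<longrightarrow> slice (flip k s i) T = 0}" for r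
  define \<eta> where "\<eta> a = tsign s * \<omega> (flip k s a)" for a
  have sq: "tsign s * tsign s = 1" by (simp add: tsign_def)
  have sub: "FS.subspace (G r)" for r
    using subspace_HW[of k "s # sg" \<omega>] unfolding FS.subspace_def G_def
    by (auto simp: fun_eq_iff)
  have wt_eq: "of_int (tsign s * (\<omega>(flip k s j := \<omega> (flip k s j) - tsign s)) (flip k s a)) =
      (of_int (\<eta> a) - (if a = j then 1 else 0) :: complex)" if "a < k" "j < k" for a j
    using that sq by (auto simp: \<eta>_def flip_eq_iff right_diff_distrib simp flip: of_int_mult)
  have \<eta>: "\<eta> b \<le> \<eta> a" if "a < b" "b < k" for a b
    using that dom by (cases s) (auto simp: \<eta>_def tsign_def dominant_def flip_def)
  have "has_dim (G r) (\<Sum>j<r. d j)" if "r \<le> k" for r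
    using that
  proof (induction r)
    case 0
    have "G 0 = {0}"
    proof -
      have "T = 0" if "T \<in> G 0" for T
      proof -
        have "slice i T = 0" for i
        proof (cases "i < k")
          case True
          with that have "slice (flip k s (flip k s i)) T = 0" by (auto simp: G_def flip_less)
          with True show ?thesis by (simp add: flip_flip)
        next
          case False
          with that show ?thesis by (simp add: G_def HW_def word_funs_Suc)
        qed
        then have "T (i # u) = 0" for i u by (metis zero_fun_apply)
        moreover have "T [] = 0" using that by (auto simp: G_def HW_def word_funs_Suc)
        ultimately show ?thesis by (intro ext, case_tac x) auto
      qed
      then show ?thesis using FS.subspace_0[OF sub[of 0]] by blast
    qed
    then show ?case by (simp add: has_dim_zero)
  next
    case (Suc r)
    then have r: "r < k" by simp
    have lin: "Vector_Spaces.linear fun_scale fun_scale (slice i)" for i :: nat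
      by (simp add: Vector_Spaces.linear_iff vector_space_fun_scale fun_eq_iff)
    let ?w = "\<omega>(flip k s r := \<omega> (flip k s r) - tsign s)"
    have "slice (flip k s r) ` G (Suc r) = HW k sg ?w"
    proof (intro equalityI subsetI)
      fix x assume "x \<in> slice (flip k s r) ` G (Suc r)"
      then obtain T where T: "T \<in> G (Suc r)" "x = slice (flip k s r) T" by auto
      then have "T \<in> HW k (s # sg) \<omega>" by (simp add: G_def)
      note C = this[unfolded HW_Cons]
      have "x \<in> word_funs k (length sg)" using C r T(2) by (auto simp: word_funs_Suc flip_less)
      moreover have "twisted k s sg a b x = 0" if "a < b" "b < k" for a b
        using C r T that by (auto simp: G_def)
      moreover have "twisted k s sg a a x = fun_scale (of_int (tsign s * ?w (flip k s a))) x" if "a < k" for a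
        unfolding wt_eq[OF that r] using C r T(2) that by (simp add: \<eta>_def)
      ultimately show "x \<in> HW k sg ?w" by (subst HW_twisted[of _ _ _ _ s]) auto
    next
      fix x assume "x \<in> HW k sg ?w"
      note C = this[unfolded HW_twisted[of _ _ _ _ s]]
      obtain m where m: "m r = x" "\<And>i. i > r \<Longrightarrow> m i = 0"
        "\<And>i a b. i < k \<Longrightarrow> a < b \<Longrightarrow> b < k \<Longrightarrow> twisted k s sg a b (m i) = (if i = a then - m b else 0)"
        "\<And>i a. i < k \<Longrightarrow> a < k \<Longrightarrow> twisted k s sg a a (m i) = fun_scale (of_int (\<eta> a) - (if a = i then 1 else 0)) (m i)"
        "\<And>i. m i \<in> word_funs k (length sg)"
      proof (rule gl_lift[of "twisted k s sg" k "word_funs k (length sg)" x r "\<lambda>a. of_int (\<eta> a)"])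
        fix b assume "b < r"
        \<comment> \<open>Dominance makes \<open>\<eta>\<close> weakly decreasing, so subtracting the index makes it strictly decreasing.\<close>
        then have "\<eta> b - int b \<noteq> \<eta> r - int r" using \<eta>[of b r] r by simp
        then have "(of_int (\<eta> b - int b) :: complex) \<noteq> of_int (\<eta> r - int r)" by (simp only: of_int_eq_iff not_False_eq_True)
        then show "of_int (\<eta> b) - of_nat b \<noteq> (of_int (\<eta> r) - of_nat r :: complex)" by simp
      next
        fix a assume "a < k"
        then show "twisted k s sg a a x = fun_scale (of_int (\<eta> a) - (if a = r then 1 else 0)) x"
          using C wt_eq[OF \<open>a < k\<close> r] by simp
      next
        show "Vector_Spaces.linear fun_scale fun_scale (twisted k s sg a b)" for a b by (rule linear_twisted)
        show "twisted k s sg a b (twisted k s sg c d x) = twisted k s sg c d (twisted k s sg a b x) +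
            (if b = c then twisted k s sg a d x else 0) - (if d = a then twisted k s sg c b x else 0)"
          if "a < k" "b < k" "c < k" "d < k" for a b c d x
          using that by (rule twisted_commutator)
        show "FS.subspace (word_funs k (length sg))" by (rule subspace_word_funs)
      qed (use C r in \<open>auto simp: twisted_word_funs\<close>)
      define T where "T = (\<lambda>w. case w of [] \<Rightarrow> 0 | i # u \<Rightarrow> if i < k then m (flip k s i) u else 0)"
      have sl: "slice i T = (if i < k then m (flip k s i) else 0)" for i
        by (auto simp: T_def fun_eq_iff)
      then have sl': "slice (flip k s i) T = m i" if "i < k" for i
        using that by (simp add: flip_less flip_flip)
      have "T [] = 0" by (simp add: T_def)
      then have "T \<in> word_funs k (Suc (length sg))"
        using m(5) by (simp add: word_funs_Suc sl)
      then have "T \<in> HW k (s # sg) \<omega>"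
        unfolding HW_Cons using m(3,4) by (auto simp: sl' \<eta>_def)
      then have "T \<in> G (Suc r)" using m(2) by (auto simp: G_def sl')
      then show "x \<in> slice (flip k s r) ` G (Suc r)"
        using sl'[OF r] m(1) by (metis image_eqI)
    qed
    moreover have "{T \<in> G (Suc r). slice (flip k s r) T = 0} = G r"
      using r unfolding G_def by (auto simp: Suc_le_eq le_less)
    ultimately have "has_dim (G (Suc r)) (d r + (\<Sum>j<r. d j))"
      using Suc d[OF r] by (intro has_dim_extension[OF lin[of "flip k s r"] sub]) auto
    then show ?case by (simp add: add.commute)
  qed
  from this[of k] show ?thesis by (simp add: G_def)
qed

lemma HW_Nil_has_dim: "has_dim (HW k [] \<omega>) (if \<forall>a<k. \<omega> a = 0 then 1 else 0)"
proof -
  define v :: "nat list \<Rightarrow> complex" where "v w = (if w = [] then 1 else 0)" for w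
  have v: "v \<noteq> 0" by (auto simp: v_def fun_eq_iff)
  have word_funs: "word_funs k 0 = {fun_scale c v |c. True}"
    by (auto simp: word_funs_def v_def fun_eq_iff)
  show ?thesis
  proof (cases "\<forall>a<k. \<omega> a = 0")
    case True
    then have "HW k [] \<omega> = {fun_scale c v |c. True}"
      unfolding word_funs[symmetric] by (auto simp: HW_def fun_eq_iff)
    with True has_dim_line[OF v] show ?thesis by simp
  next
    case False
    then obtain a where a: "a < k" "\<omega> a \<noteq> 0" by blast
    then have "T = 0" if "T \<in> HW k [] \<omega>" for T
      using that by (auto simp: HW_def fun_eq_iff)
    then have "HW k [] \<omega> = {0}" using FS.subspace_0[OF subspace_HW] by blast
    then show ?thesis unfolding if_not_P[OF False] by (simp add: has_dim_zero)
  qed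
qed

text \<open>
  The number of walks from the origin to \<open>\<omega>\<close> within the dominant chamber. A step adds a unit vector
  for an entry \<open>True\<close> and subtracts one for \<open>False\<close>; the head of the list is the last step.
\<close>

fun walks :: "nat \<Rightarrow> bool list \<Rightarrow> (nat \<Rightarrow> int) \<Rightarrow> nat" where
  "walks k [] \<omega> = (if \<forall>a<k. \<omega> a = 0 then 1 else 0)"
| "walks k (s # sg) \<omega> = (if dominant k \<omega> then \<Sum>j<k. walks k sg (\<omega>(j := \<omega> j - tsign s)) else 0)"

theorem HW_has_dim: "has_dim (HW k sg \<omega>) (walks k sg \<omega>)"
proof (induction sg arbitrary: \<omega>)
  case Nil
  show ?case using HW_Nil_has_dim[of k \<omega>] by simp
next
  case (Cons s sg)
  show ?case
  proof (cases "dominant k \<omega>")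
    case True
    have "has_dim (HW k (s # sg) \<omega>) (\<Sum>j<k. walks k sg (\<omega>(flip k s j := \<omega> (flip k s j) - tsign s)))"
      by (rule HW_Cons_has_dim[OF True Cons])
    also have "(\<Sum>j<k. walks k sg (\<omega>(flip k s j := \<omega> (flip k s j) - tsign s))) =
        (\<Sum>j<k. walks k sg (\<omega>(j := \<omega> j - tsign s)))"
      by (rule sum.reindex_bij_witness[of _ "flip k s" "flip k s"]) (auto simp: flip_less flip_flip)
    finally show ?thesis using True by simp
  next
    case False
    then show ?thesis by (simp add: HW_not_dominant has_dim_zero)
  qed
qed

section \<open>Walks in the dominant chamber and standard Young tableaux\<close>

text \<open>
  Partitions padded by zeros to length \<open>k\<close>, so that weights and shapes have the same entries.
\<close>

definition shapes :: "nat \<Rightarrow> nat \<Rightarrow> nat list set" where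
  "shapes k n = {\<mu>. length \<mu> = k \<and> sorted_wrt (\<ge>) \<mu> \<and> sum_list \<mu> = n}"

definition corner :: "nat list \<Rightarrow> nat \<Rightarrow> bool" where
  "corner \<mu> j \<longleftrightarrow> j < length \<mu> \<and> 0 < \<mu> ! j \<and> (\<forall>i. j < i \<and> i < length \<mu> \<longrightarrow> \<mu> ! i < \<mu> ! j)"

lemma sorted_desc_iff: "sorted_wrt (\<ge>) \<mu> \<longleftrightarrow> (\<forall>j<length \<mu>. \<forall>i<j. \<mu> ! j \<le> (\<mu> ! i :: nat))"
  by (auto simp: sorted_wrt_iff_nth_less)

lemma sorted_desc_replicate: "sorted_wrt (\<ge>) (replicate n (x :: nat))"
  by (simp add: sorted_desc_iff)

lemma finite_corners: "finite {j. corner \<mu> j}"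
  by (rule finite_subset[of _ "{..<length \<mu>}"]) (auto simp: corner_def)

lemma finite_shapes: "finite (shapes k n)"
proof (rule finite_subset)
  show "shapes k n \<subseteq> {\<mu>. set \<mu> \<subseteq> {..n} \<and> length \<mu> = k}"
    using member_le_sum_list by (fastforce simp: shapes_def)
qed (rule finite_lists_length_eq, simp)

lemma sum_list_remove_box:
  "j < length \<mu> \<Longrightarrow> 0 < \<mu> ! j \<Longrightarrow> sum_list \<mu> = Suc (sum_list (\<mu>[j := \<mu> ! j - 1]))" for \<mu> :: "nat list"
proof (induction \<mu> arbitrary: j)
  case (Cons a \<mu>)
  then show ?case by (cases j) auto
qed simp

lemma sum_list_add_box:
  "j < length \<mu> \<Longrightarrow> sum_list (\<mu>[j := Suc (\<mu> ! j)]) = Suc (sum_list \<mu>)" for \<mu> :: "nat list"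
  using sum_list_remove_box[of j "\<mu>[j := Suc (\<mu> ! j)]"] by simp

lemma sorted_remove_corner:
  assumes "sorted_wrt (\<ge>) \<mu>" "corner \<mu> j"
  shows "sorted_wrt (\<ge>) (\<mu>[j := \<mu> ! j - 1])"
  using assms by (fastforce simp: sorted_desc_iff corner_def nth_list_update)

lemma remove_corner_shapes:
  assumes "\<mu> \<in> shapes k (Suc n)" "corner \<mu> j"
  shows "\<mu>[j := \<mu> ! j - 1] \<in> shapes k n"
  using assms sorted_remove_corner[of \<mu> j] sum_list_remove_box[of j \<mu>]
  by (auto simp: shapes_def corner_def)

lemma cells_remove_corner:
  assumes "corner \<mu> j"
  shows "cells \<mu> = insert (j, \<mu> ! j - 1) (cells (\<mu>[j := \<mu> ! j - 1]))"
    and "(j, \<mu> ! j - 1) \<notin> cells (\<mu>[j := \<mu> ! j - 1])"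
  using assms by (auto simp: cells_def corner_def nth_list_update split: if_splits)

lemma SYT_row: "T \<in> SYT \<mu> \<Longrightarrow> (i, j) \<in> cells \<mu> \<Longrightarrow> (i, j') \<in> cells \<mu> \<Longrightarrow> j < j' \<Longrightarrow> T (i, j) < T (i, j')"
  and SYT_col: "T \<in> SYT \<mu> \<Longrightarrow> (i, j) \<in> cells \<mu> \<Longrightarrow> (i', j) \<in> cells \<mu> \<Longrightarrow> i < i' \<Longrightarrow> T (i, j) < T (i', j)"
  unfolding SYT_def by blast+

lemma SYT_range: "T \<in> SYT \<mu> \<Longrightarrow> c \<in> cells \<mu> \<Longrightarrow> 1 \<le> T c \<and> T c \<le> sum_list \<mu>"
  by (auto simp: SYT_def bij_betw_def)

text \<open>
  The largest entry may be put into a corner, because a corner has no cell to its right or below it.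
\<close>

lemma SYT_add_corner:
  assumes c: "corner \<mu> j" and T: "T \<in> SYT (\<mu>[j := \<mu> ! j - 1])"
  shows "T((j, \<mu> ! j - 1) := sum_list \<mu>) \<in> SYT \<mu>"
proof -
  let ?c = "(j, \<mu> ! j - 1)" and ?\<mu> = "\<mu>[j := \<mu> ! j - 1]" and ?n = "sum_list \<mu>"
  have n: "?n = Suc (sum_list ?\<mu>)" using c sum_list_remove_box[of j \<mu>] by (simp add: corner_def)
  note cells = cells_remove_corner[OF c]
  have lt: "T d < ?n" if "d \<in> cells ?\<mu>" for d using SYT_range[OF T that] n by simp
  have right: "d \<noteq> ?c" if "(fst d, x) \<in> cells \<mu>" "snd d < x" for d x
    using that by (auto simp: cells_def)
  have below: "d \<noteq> ?c" if "(x, snd d) \<in> cells \<mu>" "fst d < x" for d x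
    using that c by (force simp: cells_def corner_def)
  have bij: "bij_betw (T(?c := ?n)) (cells \<mu>) {1..?n}"
  proof -
    have "bij_betw T (cells ?\<mu>) {1..sum_list ?\<mu>}" using T by (simp add: SYT_def)
    then have "bij_betw (T(?c := ?n)) (cells ?\<mu>) {1..sum_list ?\<mu>}"
      using cells(2) by (subst bij_betw_cong[of _ _ T]) auto
    then have "bij_betw (T(?c := ?n)) (insert ?c (cells ?\<mu>)) (insert ((T(?c := ?n)) ?c) {1..sum_list ?\<mu>})"
      using cells(2) n by (subst notIn_Un_bij_betw3[symmetric, unfolded Un_insert_right Un_empty_right]) auto
    moreover have "insert ?n {1..sum_list ?\<mu>} = {1..?n}" using n by auto
    ultimately show ?thesis using cells(1) by simp
  qed
  have ext: "T(?c := ?n) \<in> extensional (cells \<mu>)"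
    using T cells(1) by (auto simp: SYT_def extensional_def)
  have mono: "(T(?c := ?n)) d < (T(?c := ?n)) e"
    if "d \<in> cells \<mu>" "e \<in> cells \<mu>" "d \<noteq> ?c" "d \<in> cells ?\<mu> \<Longrightarrow> e \<in> cells ?\<mu> \<Longrightarrow> T d < T e" for d e
  proof -
    have d: "d \<in> cells ?\<mu>" using that cells(1) by auto
    show ?thesis
    proof (cases "e = ?c")
      case True
      then show ?thesis using that(3) lt[OF d] by simp
    next
      case False
      then have "e \<in> cells ?\<mu>" using that cells(1) by auto
      then show ?thesis using that(3) False that(4)[OF d] by simp
    qed
  qed
  have rows: "(T(?c := ?n)) (a, b) < (T(?c := ?n)) (a, b')"
    if "(a, b) \<in> cells \<mu>" "(a, b') \<in> cells \<mu>" "b < b'" for a b b'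
    using T that right[of "(a, b)" b'] by (intro mono) (auto simp: SYT_def)
  have cols: "(T(?c := ?n)) (a, b) < (T(?c := ?n)) (a', b)"
    if "(a, b) \<in> cells \<mu>" "(a', b) \<in> cells \<mu>" "a < a'" for a a' b
    using T that below[of a' "(a, b)"] by (intro mono) (auto simp: SYT_def)
  show ?thesis unfolding SYT_def using ext bij rows cols by blast
qed

lemma SYT_remove_corner:
  assumes c: "corner \<mu> j" and T: "T \<in> SYT \<mu>" and Tc: "T (j, \<mu> ! j - 1) = sum_list \<mu>"
  shows "T((j, \<mu> ! j - 1) := undefined) \<in> SYT (\<mu>[j := \<mu> ! j - 1])"
proof -
  let ?c = "(j, \<mu> ! j - 1)" and ?\<mu> = "\<mu>[j := \<mu> ! j - 1]" and ?n = "sum_list \<mu>"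
  have n: "?n = Suc (sum_list ?\<mu>)" using c sum_list_remove_box[of j \<mu>] by (simp add: corner_def)
  note cells = cells_remove_corner[OF c]
  have "bij_betw T (cells \<mu>) {1..?n}" using T by (simp add: SYT_def)
  then have "bij_betw T (cells \<mu> - {?c}) ({1..?n} - {?n})"
    using cells(1) Tc by (intro bij_betw_DiffI) (auto simp: bij_betw_def)
  moreover have "cells \<mu> - {?c} = cells ?\<mu>" "{1..?n} - {?n} = {1..sum_list ?\<mu>}" using cells n by auto
  ultimately have "bij_betw T (cells ?\<mu>) {1..sum_list ?\<mu>}" by simp
  then have bij: "bij_betw (T(?c := undefined)) (cells ?\<mu>) {1..sum_list ?\<mu>}"
    using cells(2) by (subst bij_betw_cong[of _ _ T]) auto
  have ext: "T(?c := undefined) \<in> extensional (cells ?\<mu>)"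
    using T cells(1) by (auto simp: SYT_def extensional_def)
  have eq: "(T(?c := undefined)) d = T d \<and> d \<in> cells \<mu>" if "d \<in> cells ?\<mu>" for d using that cells by auto
  have rows: "(T(?c := undefined)) (a, b) < (T(?c := undefined)) (a, b')"
    if "(a, b) \<in> cells ?\<mu>" "(a, b') \<in> cells ?\<mu>" "b < b'" for a b b'
    using eq[OF that(1)] eq[OF that(2)] SYT_row[OF T _ _ that(3)] by simp
  have cols: "(T(?c := undefined)) (a, b) < (T(?c := undefined)) (a', b)"
    if "(a, b) \<in> cells ?\<mu>" "(a', b) \<in> cells ?\<mu>" "a < a'" for a a' b
    using eq[OF that(1)] eq[OF that(2)] SYT_col[OF T _ _ that(3)] by simp
  show ?thesis unfolding SYT_def using ext bij rows cols by blast
qed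

text \<open>
  The largest entry cannot have a cell to its right or below it.
\<close>

lemma SYT_max_corner:
  assumes T: "T \<in> SYT \<mu>" and n: "0 < sum_list \<mu>"
  shows "\<exists>j. corner \<mu> j \<and> T (j, \<mu> ! j - 1) = sum_list \<mu>"
proof -
  have "bij_betw T (cells \<mu>) {1..sum_list \<mu>}" using T by (simp add: SYT_def)
  then have "sum_list \<mu> \<in> T ` cells \<mu>" using n by (simp add: bij_betw_def)
  then obtain i j where ij: "(i, j) \<in> cells \<mu>" "T (i, j) = sum_list \<mu>" by force
  have max: "\<not> T (i, j) < T d" if "d \<in> cells \<mu>" for d using SYT_range[OF T that] ij by simp
  have j: "j = \<mu> ! i - 1"
  proof (rule ccontr)
    assume "j \<noteq> \<mu> ! i - 1"
    then have "(i, Suc j) \<in> cells \<mu>" using ij by (auto simp: cells_def)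
    moreover from this have "T (i, j) < T (i, Suc j)" using SYT_row[OF T ij(1)] by simp
    ultimately show False using max by blast
  qed
  have "\<mu> ! i' < \<mu> ! i" if i': "i < i'" "i' < length \<mu>" for i'
  proof (rule ccontr)
    assume "\<not> \<mu> ! i' < \<mu> ! i"
    then have "(i', j) \<in> cells \<mu>" using ij i' by (auto simp: cells_def)
    moreover from this have "T (i, j) < T (i', j)" using SYT_col[OF T ij(1)] i' by simp
    ultimately show False using max by blast
  qed
  then have "corner \<mu> i" using ij by (auto simp: corner_def cells_def)
  then show ?thesis using ij j by blast
qed

lemma card_SYT_corners:
  assumes "0 < sum_list \<mu>"
  shows "card (SYT \<mu>) = (\<Sum>j | corner \<mu> j. card (SYT (\<mu>[j := \<mu> ! j - 1])))"
proof -
  define S where "S j = {T \<in> SYT \<mu>. T (j, \<mu> ! j - 1) = sum_list \<mu>}" for j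
  have "SYT \<mu> = (\<Union>j\<in>{j. corner \<mu> j}. S j)"
    using SYT_max_corner[OF _ assms] by (auto simp: S_def)
  moreover have "card (\<Union>j\<in>{j. corner \<mu> j}. S j) = (\<Sum>j | corner \<mu> j. card (S j))"
  proof (rule card_UN_disjoint)
    show "\<forall>i\<in>{j. corner \<mu> j}. \<forall>j\<in>{j. corner \<mu> j}. i \<noteq> j \<longrightarrow> S i \<inter> S j = {}"
    proof (intro ballI impI equals0I)
      fix i j T assume ij: "i \<in> {j. corner \<mu> j}" "j \<in> {j. corner \<mu> j}" "i \<noteq> j" and "T \<in> S i \<inter> S j"
      then have T: "T \<in> SYT \<mu>" "T (i, \<mu> ! i - 1) = T (j, \<mu> ! j - 1)" by (auto simp: S_def)
      moreover have "(i, \<mu> ! i - 1) \<in> cells \<mu>" "(j, \<mu> ! j - 1) \<in> cells \<mu>"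
        using ij by (auto simp: corner_def cells_def)
      ultimately show False using ij(3) by (auto simp: SYT_def bij_betw_def inj_on_def)
    qed
  qed (use finite_corners[of \<mu>] finite_SYT[of \<mu>] in \<open>auto simp: S_def\<close>)
  moreover have "card (S j) = card (SYT (\<mu>[j := \<mu> ! j - 1]))" if j: "corner \<mu> j" for j
  proof -
    let ?c = "(j, \<mu> ! j - 1)"
    have "bij_betw (\<lambda>T. T(?c := sum_list \<mu>)) (SYT (\<mu>[j := \<mu> ! j - 1])) (S j)"
    proof (rule bij_betw_byWitness[where f' = "\<lambda>T. T(?c := undefined)"])
      show "\<forall>T\<in>SYT (\<mu>[j := \<mu> ! j - 1]). T(?c := sum_list \<mu>, ?c := undefined) = T"
        using cells_remove_corner(2)[OF j] by (auto simp: SYT_def extensional_def fun_eq_iff)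
    qed (use SYT_add_corner[OF j] SYT_remove_corner[OF j] in \<open>auto simp: S_def\<close>)
    then show ?thesis by (simp add: bij_betw_same_card)
  qed
  ultimately show ?thesis by simp
qed

lemma walks_cong: "(\<And>i. i < k \<Longrightarrow> \<omega> i = \<omega>' i) \<Longrightarrow> walks k sg \<omega> = walks k sg \<omega>'"
proof (induction sg arbitrary: \<omega> \<omega>')
  case (Cons s sg)
  have "dominant k \<omega> = dominant k \<omega>'" using Cons.prems by (auto simp: dominant_def)
  moreover have "walks k sg (\<omega>(j := \<omega> j - tsign s)) = walks k sg (\<omega>'(j := \<omega>' j - tsign s))" if "j < k" for j
    using Cons.prems that by (intro Cons.IH) auto
  ultimately show ?case by simp
qed simp

lemma walks_not_dominant: "\<not> dominant k \<omega> \<Longrightarrow> walks k sg \<omega> = 0"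
  by (cases sg) (auto simp: dominant_def, metis less_trans order_refl)

text \<open>
  A walk with steps up only stays above its starting point, the origin.
\<close>

lemma walks_True_nonneg: "walks k (replicate p True) \<omega> \<noteq> 0 \<Longrightarrow> i < k \<Longrightarrow> 0 \<le> \<omega> i"
proof (induction p arbitrary: \<omega>)
  case (Suc p)
  from Suc.prems(1) have "(\<Sum>j<k. walks k (replicate p True) (\<omega>(j := \<omega> j - tsign True))) \<noteq> 0"
    unfolding replicate_Suc walks.simps by presburger
  then obtain j where "walks k (replicate p True) (\<omega>(j := \<omega> j - tsign True)) \<noteq> 0"
    by (rule sum.not_neutral_contains_not_neutral)
  from Suc.IH[OF this Suc.prems(2)] show ?case by (auto simp: tsign_def split: if_splits)
qed (auto split: if_splits)

lemma dominant_shape: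
  assumes "length \<mu> = k" "\<And>i. i < k \<Longrightarrow> \<omega> i = c + int (\<mu> ! i)"
  shows "dominant k \<omega> \<longleftrightarrow> sorted_wrt (\<ge>) \<mu>"
  using assms by (auto simp: dominant_def sorted_desc_iff)

text \<open>
  A walk up corresponds to the order in which the entries of a tableau are inserted: both sides obey the
  recursion that removes a corner. The steps that do not come from a corner leave the dominant chamber or
  reach a negative coordinate and contribute nothing.
\<close>

lemma walks_True_eq_card_SYT:
  "\<mu> \<in> shapes k p \<Longrightarrow> (\<And>i. i < k \<Longrightarrow> \<omega> i = int (\<mu> ! i)) \<Longrightarrow>
     walks k (replicate p True) \<omega> = card (SYT \<mu>)"
proof (induction p arbitrary: \<mu> \<omega>)
  case 0
  then have "\<mu> ! i = 0" if "i < length \<mu>" for i using that by (auto simp: shapes_def)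
  then have "cells \<mu> = {}" by (auto simp: cells_def)
  moreover have "sum_list \<mu> = 0" using 0 by (simp add: shapes_def)
  ultimately have "SYT \<mu> = {\<lambda>_. undefined}" by (auto simp: SYT_def bij_betw_def)
  moreover have "\<omega> i = 0" if "i < k" for i using 0 that by (auto simp: shapes_def)
  ultimately show ?case by simp
next
  case (Suc p)
  have len: "length \<mu> = k" and flip: "0 < sum_list \<mu>" and sort: "sorted_wrt (\<ge>) \<mu>"
    using Suc.prems(1) by (auto simp: shapes_def)
  have "walks k (replicate p True) (\<omega>(j := \<omega> j - 1)) =
      (if corner \<mu> j then card (SYT (\<mu>[j := \<mu> ! j - 1])) else 0)" if j: "j < k" for j
  proof (cases "corner \<mu> j")
    case True
    then have "walks k (replicate p True) (\<omega>(j := \<omega> j - 1)) = card (SYT (\<mu>[j := \<mu> ! j - 1]))"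
      using Suc.prems(2) len j by (intro Suc.IH remove_corner_shapes Suc.prems(1))
        (auto simp: nth_list_update corner_def)
    with True show ?thesis by simp
  next
    case False
    have "walks k (replicate p True) (\<omega>(j := \<omega> j - 1)) = 0"
    proof (cases "\<mu> ! j = 0")
      case True
      show ?thesis
      proof (rule ccontr)
        assume "walks k (replicate p True) (\<omega>(j := \<omega> j - 1)) \<noteq> 0"
        from walks_True_nonneg[OF this j] show False using Suc.prems(2)[OF j] True by simp
      qed
    next
      case nz: False
      then obtain i where "j < i" "i < k" "\<mu> ! j \<le> \<mu> ! i"
        using False j len by (auto simp: corner_def not_less)
      moreover from this have "(\<omega>(j := \<omega> j - 1)) i \<le> (\<omega>(j := \<omega> j - 1)) j"
        if "dominant k (\<omega>(j := \<omega> j - 1))" using that unfolding dominant_def by blast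
      ultimately have "\<not> dominant k (\<omega>(j := \<omega> j - 1))"
        using Suc.prems(2)[of i] Suc.prems(2)[OF j] by auto
      then show ?thesis by (rule walks_not_dominant)
    qed
    with False show ?thesis by simp
  qed
  moreover have "dominant k \<omega>"
    using dominant_shape[of \<mu> k \<omega> 0] len Suc.prems(2) sort by simp
  ultimately have "walks k (replicate (Suc p) True) \<omega> =
      (\<Sum>j<k. if corner \<mu> j then card (SYT (\<mu>[j := \<mu> ! j - 1])) else 0)"
    by (simp add: tsign_def)
  also have "\<dots> = (\<Sum>j | corner \<mu> j. card (SYT (\<mu>[j := \<mu> ! j - 1])))"
    by (rule sum.mono_neutral_cong_right) (auto simp: corner_def len)
  finally show ?case using card_SYT_corners[OF flip] by simp
qed

lemma shapes_0: "shapes k 0 = {replicate k 0}"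
  by (auto simp: shapes_def sum_list_eq_0_iff sorted_desc_replicate intro!: replicate_eqI)

text \<open>
  Read backwards from the constant weight \<open>c\<close>, the steps down are steps up, and they trace a standard
  tableau of the shape \<open>\<nu>\<close> that has been reached relative to \<open>c\<close>.
\<close>

lemma walks_False_append:
  "walks k (replicate q False @ sg) (\<lambda>_. c) =
     (\<Sum>\<nu>\<in>shapes k q. card (SYT \<nu>) * walks k sg (\<lambda>i. c + int (\<nu> ! i)))"
proof (induction q arbitrary: sg)
  case 0
  have "card (SYT (replicate k 0)) = walks k (replicate 0 True) (\<lambda>_. 0)"
    by (rule walks_True_eq_card_SYT[symmetric]) (auto simp: shapes_0)
  then show ?case by (simp add: shapes_0) (rule walks_cong, simp)
next
  case (Suc q)
  \<comment> \<open>Adding a box to \<open>\<nu>\<close> in row \<open>j\<close> and removing the corner in row \<open>j\<close> are inverse to each other.\<close>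
  define A where "A = (SIGMA \<nu>:shapes k q. {j. j < k \<and> sorted_wrt (\<ge>) (\<nu>[j := Suc (\<nu> ! j)])})"
  define B where "B = (SIGMA \<nu>:shapes k (Suc q). {j. corner \<nu> j})"
  have upd: "walks k sg ((\<lambda>i. c + int (\<nu> ! i))(j := c + int (\<nu> ! j) + 1)) =
      walks k sg (\<lambda>i. c + int (\<nu>[j := Suc (\<nu> ! j)] ! i))" if "\<nu> \<in> shapes k q" "j < k" for \<nu> j
    using that by (intro walks_cong) (auto simp: shapes_def nth_list_update)
  have "walks k (replicate (Suc q) False @ sg) (\<lambda>_. c) = walks k (replicate q False @ (False # sg)) (\<lambda>_. c)"
    by (simp add: replicate_app_Cons_same)
  also have "\<dots> = (\<Sum>\<nu>\<in>shapes k q. card (SYT \<nu>) * walks k (False # sg) (\<lambda>i. c + int (\<nu> ! i)))"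
    by (rule Suc)
  also have "\<dots> = (\<Sum>\<nu>\<in>shapes k q. \<Sum>j | j < k \<and> sorted_wrt (\<ge>) (\<nu>[j := Suc (\<nu> ! j)]).
      card (SYT \<nu>) * walks k sg (\<lambda>i. c + int (\<nu>[j := Suc (\<nu> ! j)] ! i)))"
  proof (rule sum.cong[OF refl])
    fix \<nu> assume \<nu>: "\<nu> \<in> shapes k q"
    then have dom: "dominant k (\<lambda>i. c + int (\<nu> ! i))"
      using dominant_shape[of \<nu> k _ c] by (auto simp: shapes_def)
    have "walks k (False # sg) (\<lambda>i. c + int (\<nu> ! i)) =
       (\<Sum>j<k. walks k sg (\<lambda>i. c + int (\<nu>[j := Suc (\<nu> ! j)] ! i)))"
      using dom upd[OF \<nu>] by (simp add: tsign_def)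
    also have "\<dots> = (\<Sum>j | j < k \<and> sorted_wrt (\<ge>) (\<nu>[j := Suc (\<nu> ! j)]).
        walks k sg (\<lambda>i. c + int (\<nu>[j := Suc (\<nu> ! j)] ! i)))"
    proof (rule sum.mono_neutral_right)
      show "\<forall>j\<in>{..<k} - {j. j < k \<and> sorted_wrt (\<ge>) (\<nu>[j := Suc (\<nu> ! j)])}.
          walks k sg (\<lambda>i. c + int (\<nu>[j := Suc (\<nu> ! j)] ! i)) = 0"
      proof
        fix j assume "j \<in> {..<k} - {j. j < k \<and> sorted_wrt (\<ge>) (\<nu>[j := Suc (\<nu> ! j)])}"
        then have "\<not> dominant k (\<lambda>i. c + int (\<nu>[j := Suc (\<nu> ! j)] ! i))"
          using \<nu> dominant_shape[of "\<nu>[j := Suc (\<nu> ! j)]" k _ c] by (auto simp: shapes_def)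
        then show "walks k sg (\<lambda>i. c + int (\<nu>[j := Suc (\<nu> ! j)] ! i)) = 0"
          by (rule walks_not_dominant)
      qed
    qed auto
    finally show "card (SYT \<nu>) * walks k (False # sg) (\<lambda>i. c + int (\<nu> ! i)) =
        (\<Sum>j | j < k \<and> sorted_wrt (\<ge>) (\<nu>[j := Suc (\<nu> ! j)]).
          card (SYT \<nu>) * walks k sg (\<lambda>i. c + int (\<nu>[j := Suc (\<nu> ! j)] ! i)))"
      by (simp add: sum_distrib_left)
  qed
  also have "\<dots> = (\<Sum>(\<nu>, j)\<in>A. card (SYT \<nu>) * walks k sg (\<lambda>i. c + int (\<nu>[j := Suc (\<nu> ! j)] ! i)))"
    unfolding A_def by (rule sum.Sigma) (auto simp: finite_shapes)
  also have "\<dots> = (\<Sum>(\<nu>, j)\<in>B. card (SYT (\<nu>[j := \<nu> ! j - 1])) * walks k sg (\<lambda>i. c + int (\<nu> ! i)))"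
  proof (rule sum.reindex_bij_witness[where i = "\<lambda>(\<nu>, j). (\<nu>[j := \<nu> ! j - 1], j)"
        and j = "\<lambda>(\<nu>, j). (\<nu>[j := Suc (\<nu> ! j)], j)"])
    fix x assume x: "x \<in> A"
    then obtain \<nu> j where [simp]: "x = (\<nu>, j)" and \<nu>: "\<nu> \<in> shapes k q" "j < k"
      "sorted_wrt (\<ge>) (\<nu>[j := Suc (\<nu> ! j)])" by (auto simp: A_def)
    have len: "length \<nu> = k" using \<nu> by (simp add: shapes_def)
    show "(case case x of (\<nu>, j) \<Rightarrow> (\<nu>[j := Suc (\<nu> ! j)], j) of (\<nu>, j) \<Rightarrow> (\<nu>[j := \<nu> ! j - 1], j)) = x"
      using \<nu> len by simp
    have "\<nu>[j := Suc (\<nu> ! j)] \<in> shapes k (Suc q)"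
      using \<nu> sum_list_add_box[of j \<nu>] by (auto simp: shapes_def)
    moreover have "corner (\<nu>[j := Suc (\<nu> ! j)]) j"
      using \<nu> len by (auto simp: corner_def shapes_def sorted_desc_iff less_Suc_eq_le)
    ultimately show "(case x of (\<nu>, j) \<Rightarrow> (\<nu>[j := Suc (\<nu> ! j)], j)) \<in> B"
      by (simp add: B_def)
    show "(case case x of (\<nu>, j) \<Rightarrow> (\<nu>[j := Suc (\<nu> ! j)], j) of (\<nu>, j) \<Rightarrow>
          card (SYT (\<nu>[j := \<nu> ! j - 1])) * walks k sg (\<lambda>i. c + int (\<nu> ! i))) =
        (case x of (\<nu>, j) \<Rightarrow> card (SYT \<nu>) * walks k sg (\<lambda>i. c + int (\<nu>[j := Suc (\<nu> ! j)] ! i)))"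
      using \<nu> len by simp
  next
    fix x assume x: "x \<in> B"
    then obtain \<nu> j where [simp]: "x = (\<nu>, j)" and \<nu>: "\<nu> \<in> shapes k (Suc q)" "corner \<nu> j"
      by (auto simp: B_def)
    have len: "length \<nu> = k" and j: "j < k" "0 < \<nu> ! j" using \<nu> by (auto simp: shapes_def corner_def)
    show "(case case x of (\<nu>, j) \<Rightarrow> (\<nu>[j := \<nu> ! j - 1], j) of (\<nu>, j) \<Rightarrow> (\<nu>[j := Suc (\<nu> ! j)], j)) = x"
      using j len by simp
    show "(case x of (\<nu>, j) \<Rightarrow> (\<nu>[j := \<nu> ! j - 1], j)) \<in> A"
      using remove_corner_shapes[OF \<nu>] \<nu> j len by (simp add: A_def shapes_def)
  qed
  also have "\<dots> = (\<Sum>\<nu>\<in>shapes k (Suc q). \<Sum>j | corner \<nu> j.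
      card (SYT (\<nu>[j := \<nu> ! j - 1])) * walks k sg (\<lambda>i. c + int (\<nu> ! i)))"
    unfolding B_def
    by (rule sum.Sigma[symmetric]) (auto simp: finite_shapes finite_corners)
  also have "\<dots> = (\<Sum>\<nu>\<in>shapes k (Suc q). card (SYT \<nu>) * walks k sg (\<lambda>i. c + int (\<nu> ! i)))"
    by (intro sum.cong refl) (subst card_SYT_corners, auto simp: shapes_def sum_distrib_right)
  finally show ?case .
qed

definition pad :: "nat \<Rightarrow> nat list \<Rightarrow> nat list" where
  "pad k \<mu> = \<mu> @ replicate (k - length \<mu>) 0"

lemma SYT_pad: "SYT (pad k \<mu>) = SYT \<mu>"
proof -
  have "cells (pad k \<mu>) = cells \<mu>" by (auto simp: cells_def pad_def nth_append split: if_splits)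
  moreover have "sum_list (pad k \<mu>) = sum_list \<mu>" by (simp add: pad_def)
  ultimately show ?thesis by (simp add: SYT_def)
qed

lemma sorted_desc_zeros:
  assumes "sorted_wrt (\<ge>) (\<nu> :: nat list)"
  shows "takeWhile ((<) 0) \<nu> @ replicate (length \<nu> - length (takeWhile ((<) 0) \<nu>)) 0 = \<nu>"
  using assms
proof (induction \<nu>)
  case (Cons a \<nu>)
  show ?case
  proof (cases "0 < a")
    case False
    then have "\<forall>x\<in>set (a # \<nu>). x = 0" using Cons.prems by auto
    then have "a # \<nu> = replicate (length (a # \<nu>)) 0" by (metis replicate_eqI)
    with False show ?thesis by simp
  qed (use Cons in auto)
qed simp

lemma bij_betw_pad: "bij_betw (pad k) {\<mu>. is_partition n \<mu> \<and> length \<mu> \<le> k} (shapes k n)"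
proof (rule bij_betw_byWitness[where f' = "takeWhile ((<) 0)"])
  show "\<forall>\<mu>\<in>{\<mu>. is_partition n \<mu> \<and> length \<mu> \<le> k}. takeWhile ((<) 0) (pad k \<mu>) = \<mu>"
    by (auto simp: pad_def is_partition_def takeWhile_append takeWhile_replicate takeWhile_eq_all_conv)
  show z: "\<forall>\<nu>\<in>shapes k n. pad k (takeWhile ((<) 0) \<nu>) = \<nu>"
    using sorted_desc_zeros by (auto simp: pad_def shapes_def)
  show "pad k ` {\<mu>. is_partition n \<mu> \<and> length \<mu> \<le> k} \<subseteq> shapes k n"
    by (auto simp: pad_def is_partition_def shapes_def sorted_wrt_append sorted_desc_replicate)
  show "takeWhile ((<) 0) ` shapes k n \<subseteq> {\<mu>. is_partition n \<mu> \<and> length \<mu> \<le> k}"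
  proof
    fix \<mu> assume "\<mu> \<in> takeWhile ((<) 0) ` shapes k n"
    then obtain \<nu> where \<nu>: "\<nu> \<in> shapes k n" "\<mu> = takeWhile ((<) 0) \<nu>" by blast
    have "sum_list \<mu> = sum_list (pad k \<mu>)" by (simp add: pad_def)
    also have "\<dots> = n" using z \<nu> by (auto simp: shapes_def)
    finally have "sum_list \<mu> = n" .
    moreover have "length \<mu> \<le> k" using \<nu> length_takeWhile_le[of _ \<nu>] by (auto simp: shapes_def)
    moreover have "sorted_wrt (\<ge>) \<mu>"
    proof -
      have "\<mu> = take (length \<mu>) \<nu>" using takeWhile_eq_take[of "(<) 0" \<nu>] \<nu>(2) by simp
      moreover have "sorted_wrt (\<ge>) \<nu>" using \<nu> by (simp add: shapes_def)
      ultimately show ?thesis by (metis sorted_wrt_take)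
    qed
    moreover have "\<forall>x\<in>set \<mu>. 0 < x" using \<nu> set_takeWhileD[of _ "(<) 0" \<nu>] by auto
    ultimately show "\<mu> \<in> {\<mu>. is_partition n \<mu> \<and> length \<mu> \<le> k}" by (simp add: is_partition_def)
  qed
qed

lemma sum_list_map_add: "sum_list (map (\<lambda>x. x + m) \<mu>) = sum_list \<mu> + m * length \<mu>" for m :: nat
  by (induction \<mu>) auto

lemma add_shapes: "\<mu> \<in> shapes k n \<Longrightarrow> map (\<lambda>x. x + m) \<mu> \<in> shapes k (n + m * k)"
  by (auto simp: shapes_def sorted_desc_iff sum_list_map_add)

lemma walks_eq_sum_SYT:
  assumes "int p - int q = c * int k" and "\<bar>c\<bar> = int m"
  shows "walks k (replicate q False @ replicate p True) (\<lambda>_. c) =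
    (\<Sum>\<mu> | is_partition (min p q) \<mu> \<and> length \<mu> \<le> k.
       card (SYT (add_columns k m \<mu>)) * card (SYT \<mu>))"
proof -
  have "(\<Sum>\<nu>\<in>shapes k q. card (SYT \<nu>) * walks k (replicate p True) (\<lambda>i. c + int (\<nu> ! i))) =
      (\<Sum>\<nu>\<in>shapes k (min p q). card (SYT (map (\<lambda>x. x + m) \<nu>)) * card (SYT \<nu>))"
  proof (cases "c \<ge> 0")
    case True
    then have c: "c = int m" using assms by simp
    then have "int p = int (q + m * k)" using assms by simp
    then have p: "p = q + m * k" by (simp only: of_nat_eq_iff)
    have "walks k (replicate p True) (\<lambda>i. c + int (\<nu> ! i)) = card (SYT (map (\<lambda>x. x + m) \<nu>))"
      if "\<nu> \<in> shapes k q" for \<nu>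
      using add_shapes[OF that, of m] that unfolding p
      by (intro walks_True_eq_card_SYT) (auto simp: c shapes_def)
    then show ?thesis by (simp add: p mult.commute)
  next
    case False
    then have c: "c = - int m" using assms by simp
    then have "int q = int (p + m * k)" using assms by simp
    then have q: "q = p + m * k" by (simp only: of_nat_eq_iff)
    \<comment> \<open>A walk up from the origin to \<open>\<nu> - m\<close> exists only if every row of \<open>\<nu>\<close> has at least \<open>m\<close> boxes.\<close>
    let ?f = "map (\<lambda>x. x + m)"
    have "(\<Sum>\<nu>\<in>shapes k q. card (SYT \<nu>) * walks k (replicate p True) (\<lambda>i. c + int (\<nu> ! i))) =
        (\<Sum>\<nu>\<in>?f ` shapes k p. card (SYT \<nu>) * walks k (replicate p True) (\<lambda>i. c + int (\<nu> ! i)))"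
    proof (rule sum.mono_neutral_right)
      show "?f ` shapes k p \<subseteq> shapes k q" using add_shapes[of _ k p m] by (auto simp: q)
      show "\<forall>\<nu>\<in>shapes k q - ?f ` shapes k p.
          card (SYT \<nu>) * walks k (replicate p True) (\<lambda>i. c + int (\<nu> ! i)) = 0"
      proof
        fix \<nu> assume \<nu>: "\<nu> \<in> shapes k q - ?f ` shapes k p"
        then have len: "length \<nu> = k" by (simp add: shapes_def)
        show "card (SYT \<nu>) * walks k (replicate p True) (\<lambda>i. c + int (\<nu> ! i)) = 0"
        proof (rule ccontr)
          assume "card (SYT \<nu>) * walks k (replicate p True) (\<lambda>i. c + int (\<nu> ! i)) \<noteq> 0"
          then have "walks k (replicate p True) (\<lambda>i. c + int (\<nu> ! i)) \<noteq> 0" by simp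
          from walks_True_nonneg[OF this] have ge: "m \<le> \<nu> ! i" if "i < k" for i using that c by force
          define \<mu> where "\<mu> = map (\<lambda>x. x - m) \<nu>"
          have f: "?f \<mu> = \<nu>" using ge len by (intro nth_equalityI) (auto simp: \<mu>_def)
          have "sum_list (?f \<mu>) = sum_list \<mu> + m * k"
            using len by (simp only: sum_list_map_add) (simp add: \<mu>_def)
          then have "sum_list \<mu> = p" using \<nu> f by (simp add: shapes_def q)
          moreover have "sorted_wrt (\<ge>) \<mu>"
            using \<nu> by (auto simp: shapes_def \<mu>_def sorted_desc_iff intro: diff_le_mono)
          ultimately have "\<mu> \<in> shapes k p" using len by (simp add: shapes_def \<mu>_def)
          with \<nu> f show False by blast
        qed
      qed
    qed (rule finite_shapes)
    also have "\<dots> = (\<Sum>\<nu>\<in>shapes k p. card (SYT (?f \<nu>)) * walks k (replicate p True) (\<lambda>i. c + int (?f \<nu> ! i)))"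
      by (rule sum.reindex[unfolded comp_def]) (auto simp: inj_on_def)
    also have "\<dots> = (\<Sum>\<nu>\<in>shapes k p. card (SYT (?f \<nu>)) * card (SYT \<nu>))"
    proof (rule sum.cong[OF refl])
      fix \<nu> assume \<nu>: "\<nu> \<in> shapes k p"
      then have "walks k (replicate p True) (\<lambda>i. c + int (?f \<nu> ! i)) = card (SYT \<nu>)"
        by (intro walks_True_eq_card_SYT) (auto simp: c shapes_def)
      then show "card (SYT (?f \<nu>)) * walks k (replicate p True) (\<lambda>i. c + int (?f \<nu> ! i)) =
        card (SYT (?f \<nu>)) * card (SYT \<nu>)" by simp
    qed
    finally show ?thesis by (simp add: q)
  qed
  also have "\<dots> = (\<Sum>\<mu> | is_partition (min p q) \<mu> \<and> length \<mu> \<le> k.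
      card (SYT (map (\<lambda>x. x + m) (pad k \<mu>))) * card (SYT (pad k \<mu>)))"
    by (rule sum.reindex_bij_betw[OF bij_betw_pad, symmetric])
  finally show ?thesis
    unfolding walks_False_append SYT_pad by (simp add: pad_def add_columns_def)
qed

section \<open>The special linear group acting on functions on words\<close>

lemma sum_fun_apply: "(\<Sum>i\<in>I. f i) x = (\<Sum>i\<in>I. f i x)" for f :: "'i \<Rightarrow> 'x \<Rightarrow> complex"
  by (induction I rule: infinite_finite_induct) auto

text \<open>
  The action of a group element with matrix \<open>A\<close> whose inverse has matrix \<open>B\<close>: the coordinates of a
  vector are multiplied by \<open>A\<close>, those of a covector by the transpose of \<open>B\<close>. The two matrices are
  independent arguments so that the action is polynomial in their entries.
\<close>

primrec GL_act :: "nat \<Rightarrow> bool list \<Rightarrow> (nat \<Rightarrow> nat \<Rightarrow> complex) \<Rightarrow> (nat \<Rightarrow> nat \<Rightarrow> complex) \<Rightarrow>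
    (nat list \<Rightarrow> complex) \<Rightarrow> nat list \<Rightarrow> complex" where
  "GL_act k [] A B T = T"
| "GL_act k (s # sg) A B T = (\<lambda>w. case w of [] \<Rightarrow> 0 | i # u \<Rightarrow>
     if i < k then \<Sum>j<k. (if s then A i j else B j i) * GL_act k sg A B (\<lambda>u. T (j # u)) u else 0)"

lemma GL_act_add: "GL_act k sg A B (S + T) = GL_act k sg A B S + GL_act k sg A B T"
proof (induction sg arbitrary: S T)
  case (Cons s sg)
  have "GL_act k sg A B (slice i (S + T)) = GL_act k sg A B (slice i S) + GL_act k sg A B (slice i T)" for i
    using Cons.IH[of "slice i S" "slice i T"] by (simp add: plus_fun_def)
  then show ?case by (auto simp: fun_eq_iff sum.distrib algebra_simps split: list.split)
qed (simp add: fun_eq_iff)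

lemma GL_act_scale: "GL_act k sg A B (fun_scale c T) = fun_scale c (GL_act k sg A B T)"
proof (induction sg arbitrary: T)
  case (Cons s sg)
  have "GL_act k sg A B (slice i (fun_scale c T)) = fun_scale c (GL_act k sg A B (slice i T))" for i
    using Cons.IH[of "slice i T"] by (simp add: fun_scale_def)
  then show ?case by (auto simp: fun_eq_iff sum_distrib_left algebra_simps split: list.split)
qed (simp add: fun_eq_iff)

lemma linear_GL_act: "Vector_Spaces.linear fun_scale fun_scale (GL_act k sg A B)"
  by (simp add: Vector_Spaces.linear_iff vector_space_fun_scale GL_act_add GL_act_scale)

lemma GL_act_zero [simp]: "GL_act k sg A B 0 = 0"
  using GL_act_scale[of k sg A B 0 0] by (simp add: fun_scale_def zero_fun_def)

lemma GL_act_uminus: "GL_act k sg A B (- T) = - GL_act k sg A B T"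
  using GL_act_scale[of k sg A B "-1" T] by (simp add: fun_scale_def fun_Compl_def)

lemma GL_act_cong:
  assumes "\<And>i j. i < k \<Longrightarrow> j < k \<Longrightarrow> A i j = A' i j" "\<And>i j. i < k \<Longrightarrow> j < k \<Longrightarrow> B i j = B' i j"
  shows "GL_act k sg A B T = GL_act k sg A' B' T"
proof (induction sg arbitrary: T)
  case (Cons s sg)
  show ?case using assms by (auto simp: fun_eq_iff Cons.IH split: list.split intro!: sum.cong)
qed simp

lemma GL_act_one:
  assumes "T \<in> word_funs k (length sg)"
    and "\<And>i j. i < k \<Longrightarrow> j < k \<Longrightarrow> A i j = (if i = j then 1 else 0)"
    and "\<And>i j. i < k \<Longrightarrow> j < k \<Longrightarrow> B i j = (if i = j then 1 else 0)"
  shows "GL_act k sg A B T = T"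
  using assms(1)
proof (induction sg arbitrary: T)
  case (Cons s sg)
  have IH: "GL_act k sg A B (slice i T) = slice i T" if "i < k" for i
    using Cons.prems that by (intro Cons.IH) (simp add: word_funs_Suc)
  show ?case
  proof
    fix w show "GL_act k (s # sg) A B T w = T w"
    proof (cases w)
      case Nil
      then show ?thesis using Cons.prems by (simp add: word_funs_Suc)
    next
      case (Cons i u)
      show ?thesis
      proof (cases "i < k")
        case True
        have "GL_act k (s # sg) A B T w = (\<Sum>j<k. (if s then A i j else B j i) * GL_act k sg A B (slice j T) u)"
          using True Cons by simp
        also have "\<dots> = (\<Sum>j<k. if i = j then T (j # u) else 0)"
          using True by (intro sum.cong) (auto simp: assms IH)
        finally have "GL_act k (s # sg) A B T w = (\<Sum>j<k. if i = j then T (j # u) else 0)" .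
        then show ?thesis using True Cons by simp
      next
        case False
        then have "slice i T = 0" using Cons.prems by (simp add: word_funs_Suc)
        then have "T (i # u) = 0" by (metis zero_fun_apply)
        then show ?thesis using False Cons by simp
      qed
    qed
  qed
qed simp

lemma GL_act_mult:
  "GL_act k sg A B (GL_act k sg A' B' T) =
    GL_act k sg (\<lambda>i j. \<Sum>l<k. A i l * A' l j) (\<lambda>i j. \<Sum>l<k. B' i l * B l j) T"
proof (induction sg arbitrary: T)
  case (Cons s sg)
  interpret L: Vector_Spaces.linear fun_scale fun_scale "GL_act k sg A B" by (rule linear_GL_act)
  let ?A = "\<lambda>i j. \<Sum>l<k. A i l * A' l j" and ?B = "\<lambda>i j. \<Sum>l<k. B' i l * B l j"
  show ?case
  proof
    fix w show "GL_act k (s # sg) A B (GL_act k (s # sg) A' B' T) w = GL_act k (s # sg) ?A ?B T w"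
    proof (cases w)
      case (Cons i u)
      show ?thesis
      proof (cases "i < k")
        case True
        have sl: "slice j (GL_act k (s # sg) A' B' T) =
            (\<Sum>l<k. fun_scale (if s then A' j l else B' l j) (GL_act k sg A' B' (slice l T)))" if "j < k" for j
          using that by (simp add: fun_eq_iff sum_fun_apply)
        have "GL_act k sg A B (slice j (GL_act k (s # sg) A' B' T)) u =
            (\<Sum>l<k. (if s then A' j l else B' l j) * GL_act k sg ?A ?B (slice l T) u)" if "j < k" for j
          unfolding sl[OF that] L.sum L.scale Cons.IH by (simp add: sum_fun_apply)
        then have "GL_act k (s # sg) A B (GL_act k (s # sg) A' B' T) w =
            (\<Sum>j<k. \<Sum>l<k. (if s then A i j else B j i) *
               ((if s then A' j l else B' l j) * GL_act k sg ?A ?B (slice l T) u))"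
          using True Cons by (simp add: sum_distrib_left del: GL_act.simps add: GL_act.simps(2)[of k s sg A B])
        also have "\<dots> = (\<Sum>l<k. \<Sum>j<k. (if s then A i j else B j i) *
               ((if s then A' j l else B' l j) * GL_act k sg ?A ?B (slice l T) u))"
          by (rule sum.swap)
        also have "\<dots> = GL_act k (s # sg) ?A ?B T w"
          using True Cons by (auto simp: sum_distrib_right mult.assoc mult.commute mult.left_commute intro!: sum.cong)
        finally show ?thesis .
      qed (simp add: Cons)
    qed simp
  qed
qed simp

text \<open>
  The entries of the transvection \<open>I + t E\<^sub>a\<^sub>b\<close>; its inverse is given by \<open>- t\<close> when \<open>a \<noteq> b\<close>.
\<close>

definition transv :: "nat \<Rightarrow> nat \<Rightarrow> complex \<Rightarrow> nat \<Rightarrow> nat \<Rightarrow> complex" where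
  "transv a b t i j = (if i = j then 1 else 0) + (if i = a \<and> j = b then t else 0)"

abbreviation GL_act_transv :: "nat \<Rightarrow> bool list \<Rightarrow> nat \<Rightarrow> nat \<Rightarrow> complex \<Rightarrow> (nat list \<Rightarrow> complex) \<Rightarrow> nat list \<Rightarrow> complex" where
  "GL_act_transv k sg a b t \<equiv> GL_act k sg (transv a b t) (transv a b (- t))"

lemma GL_act_transv_Cons:
  assumes "a < k" "b < k" "i < k"
  shows "GL_act_transv k (s # sg) a b t T (i # u) = GL_act_transv k sg a b t (slice i T) u +
    t * (if s then (if i = a then GL_act_transv k sg a b t (slice b T) u else 0)
     else (if i = b then - GL_act_transv k sg a b t (slice a T) u else 0))"
proof (cases s)
  case True
  have "GL_act_transv k (s # sg) a b t T (i # u) = (\<Sum>j<k. (if i = j then GL_act_transv k sg a b t (slice j T) u else 0) +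
      (if j = b then if i = a then t * GL_act_transv k sg a b t (slice j T) u else 0 else 0))"
    using True assms by (auto simp: transv_def distrib_right left_diff_distrib intro!: sum.cong)
  then show ?thesis using assms True by (simp add: sum.distrib)
next
  case False
  have "GL_act_transv k (s # sg) a b t T (i # u) = (\<Sum>j<k. (if i = j then GL_act_transv k sg a b t (slice j T) u else 0) +
      (if j = a then if i = b then - t * GL_act_transv k sg a b t (slice j T) u else 0 else 0))"
    using False assms by (auto simp: transv_def distrib_right left_diff_distrib intro!: sum.cong)
  then show ?thesis using assms False by (simp add: sum.distrib)
qed

text \<open>
  For \<open>a \<noteq> b\<close> the transvections form a one-parameter group with generator \<open>E\<^sub>a\<^sub>b\<close>. This differential equation
  is the form in which that is used.
\<close>

lemma GL_act_transv_derivative: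
  assumes "a < k" "b < k" "a \<noteq> b"
  shows "((\<lambda>t. GL_act_transv k sg a b t T w) has_field_derivative GL_act_transv k sg a b t (gl_act sg a b T) w) (at t)"
proof (induction sg arbitrary: T w)
  case (Cons s sg)
  show ?case
  proof (cases w)
    case (Cons i u)
    show ?thesis
    proof (cases "i < k")
      case True
      have sl: "GL_act_transv k sg a b t (slice i (gl_act (s # sg) a b T)) u = GL_act_transv k sg a b t (gl_act sg a b (slice i T)) u +
         (if s then (if i = a then GL_act_transv k sg a b t (slice b T) u else 0)
          else (if i = b then - GL_act_transv k sg a b t (slice a T) u else 0))"
        unfolding slice_gl_act GL_act_add by (auto simp: GL_act_uminus)
      have sa: "GL_act_transv k sg a b t (slice a (gl_act (False # sg) a b T)) u = GL_act_transv k sg a b t (gl_act sg a b (slice a T)) u"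
        unfolding slice_gl_act GL_act_add using assms by simp
      have sb: "GL_act_transv k sg a b t (slice b (gl_act (True # sg) a b T)) u = GL_act_transv k sg a b t (gl_act sg a b (slice b T)) u"
        unfolding slice_gl_act GL_act_add using assms by simp
      note IH = Cons.IH
      have prod: "((\<lambda>t. GL_act_transv k sg a b t S u + t * GL_act_transv k sg a b t S' u) has_field_derivative
          GL_act_transv k sg a b t (gl_act sg a b S) u +
          (1 * GL_act_transv k sg a b t S' u + GL_act_transv k sg a b t (gl_act sg a b S') u * t)) (at t)" for S S'
        by (intro DERIV_add DERIV_mult DERIV_ident IH)
      have prod': "((\<lambda>t. GL_act_transv k sg a b t S u - t * GL_act_transv k sg a b t S' u) has_field_derivative
          GL_act_transv k sg a b t (gl_act sg a b S) u -
          (1 * GL_act_transv k sg a b t S' u + GL_act_transv k sg a b t (gl_act sg a b S') u * t)) (at t)" for S S'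
        by (intro DERIV_diff DERIV_mult DERIV_ident IH)
      consider "s" "i = a" | "\<not> s" "i = b" | "(if s then i \<noteq> a else i \<noteq> b)" by metis
      then show ?thesis
      proof cases
        case 1
        then show ?thesis using prod[of "slice i T" "slice b T"]
          unfolding Cons GL_act_transv_Cons[OF assms(1,2) True] sl by (simp add: sb mult.commute add.assoc del: gl_act.simps)
      next
        case 2
        then show ?thesis using prod'[of "slice i T" "slice a T"]
          unfolding Cons GL_act_transv_Cons[OF assms(1,2) True] sl by (simp add: sa algebra_simps del: gl_act.simps)
      next
        case 3
        then show ?thesis using IH[of "slice i T" u]
          unfolding Cons GL_act_transv_Cons[OF assms(1,2) True] sl by (simp split: if_splits del: gl_act.simps)
      qed
    qed (simp add: Cons)
  qed simp
qed simp

text \<open>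
  The real and imaginary parts are constant along the segment from \<open>0\<close> to \<open>t\<close>.
\<close>

lemma zero_derivative_constant:
  fixes f :: "complex \<Rightarrow> complex"
  assumes "\<And>t. (f has_field_derivative 0) (at t)"
  shows "f t = f 0"
proof -
  have "((\<lambda>x. f (of_real x * t)) has_vector_derivative 0) (at x)" for x
  proof -
    have "((\<lambda>x. of_real x * t) has_derivative (\<lambda>x. of_real x * t)) (at x)"
      by (auto intro!: derivative_eq_intros)
    moreover have "(f has_derivative (\<lambda>_. 0)) (at (of_real x * t))"
      using assms[of "of_real x * t"] by (simp add: has_field_derivative_def lambda_zero)
    ultimately have "((\<lambda>x. f (of_real x * t)) has_derivative (\<lambda>_. 0)) (at x)"
      by (rule has_derivative_compose)
    then show ?thesis by (simp add: has_vector_derivative_def)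
  qed
  then have "\<forall>x. DERIV (\<lambda>x. Re (f (of_real x * t))) x :> 0" "\<forall>x. DERIV (\<lambda>x. Im (f (of_real x * t))) x :> 0"
    using has_field_derivative_Re[of _ 0] has_field_derivative_Im[of _ 0] by (metis zero_complex.sel)+
  then have "Re (f (of_real 1 * t)) = Re (f (of_real 0 * t))" "Im (f (of_real 1 * t)) = Im (f (of_real 0 * t))"
    using DERIV_isconst_all[of "\<lambda>x. Re (f (of_real x * t))" 1 0]
      DERIV_isconst_all[of "\<lambda>x. Im (f (of_real x * t))" 1 0] by simp_all
  then show ?thesis by (simp add: complex_eq_iff)
qed

text \<open>
  If all transvections fix \<open>T\<close>, the derivative at \<open>t = 0\<close> shows that \<open>E\<^sub>a\<^sub>b\<close> kills it. If \<open>E\<^sub>a\<^sub>b\<close> kills \<open>T\<close>, the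
  curve \<open>t \<mapsto> (I + t E\<^sub>a\<^sub>b) T\<close> has zero derivative everywhere.
\<close>

lemma GL_act_transv_fixes_iff:
  assumes T: "T \<in> word_funs k (length sg)" and ab: "a < k" "b < k" "a \<noteq> b"
  shows "(\<forall>t. GL_act_transv k sg a b t T = T) \<longleftrightarrow> gl_act sg a b T = 0"
proof
  have one: "GL_act_transv k sg a b 0 S = S" if "S \<in> word_funs k (length sg)" for S
    using that by (intro GL_act_one) (auto simp: transv_def)
  {
    assume fixed: "\<forall>t. GL_act_transv k sg a b t T = T"
    have "gl_act sg a b T w = 0" for w
    proof -
      have "((\<lambda>t. GL_act_transv k sg a b t T w) has_field_derivative GL_act_transv k sg a b 0 (gl_act sg a b T) w) (at 0)"
        by (rule GL_act_transv_derivative[OF ab])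
      then have "((\<lambda>t. T w) has_field_derivative gl_act sg a b T w) (at (0::complex))"
        using fixed one[OF gl_act_word_funs[OF ab(1,2) T]] by simp
      then show ?thesis using DERIV_unique DERIV_const by blast
    qed
    then show "gl_act sg a b T = 0" by (simp add: fun_eq_iff)
  }
  {
    assume "gl_act sg a b T = 0"
    then have "((\<lambda>t. GL_act_transv k sg a b t T w) has_field_derivative 0) (at t)" for t w
      using GL_act_transv_derivative[OF ab, of sg T w t] by simp
    then have "GL_act_transv k sg a b t T w = GL_act_transv k sg a b 0 T w" for t w
      by (rule zero_derivative_constant)
    then show "\<forall>t. GL_act_transv k sg a b t T = T" using one[OF T] by (simp add: fun_eq_iff)
  }
qed

text \<open>
  The identity matrix acts as \<open>1\<close> on \<open>V\<close> and as \<open>- 1\<close> on \<open>V*\<close>.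
\<close>

lemma gl_act_euler:
  "T \<in> word_funs k (length sg) \<Longrightarrow> (\<Sum>a<k. gl_act sg a a T w) = of_int (sum_list (map tsign sg)) * T w"
proof (induction sg arbitrary: T w)
  case (Cons s sg)
  show ?case
  proof (cases w)
    case Nil
    then show ?thesis using Cons.prems by (simp add: word_funs_Suc)
  next
    case (Cons i u)
    have "slice i T \<in> word_funs k (length sg) \<and> (i \<ge> k \<longrightarrow> T (i # u) = 0)"
      using Cons.prems FS.subspace_0[OF subspace_word_funs] unfolding word_funs_def
      by (auto simp: words_def)
    moreover have "(\<Sum>a<k. if s then if i = a then T (a # u) else 0 else if i = a then - T (a # u) else 0) =
        (if i < k then of_int (tsign s) * T (i # u) else 0)"
      by (cases s) (auto simp: tsign_def)
    ultimately show ?thesis using Cons.IH[of "slice i T" u] Cons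
      by (simp add: sum.distrib algebra_simps)
  qed
qed (simp)

text \<open>
  The off-diagonal matrix units kill \<open>T\<close>, hence so do their commutators \<open>E\<^sub>a\<^sub>a - E\<^sub>b\<^sub>b\<close>. The diagonal matrix
  units therefore act alike on \<open>T\<close>, and their sum is known.
\<close>

lemma HW_if_transv_fixed:
  assumes T: "T \<in> word_funs k (length sg)" and deg: "sum_list (map tsign sg) = c * int k"
    and fixed: "\<And>a b t. a < k \<Longrightarrow> b < k \<Longrightarrow> a \<noteq> b \<Longrightarrow> GL_act_transv k sg a b t T = T"
  shows "T \<in> HW k sg (\<lambda>_. c)"
proof -
  have E0: "gl_act sg a b T = 0" if "a < k" "b < k" "a \<noteq> b" for a b
    using GL_act_transv_fixes_iff[OF T that] fixed[OF that] by blast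
  have eq: "gl_act sg a a T = gl_act sg b b T" if "a < k" "b < k" for a b
    using gl_act_commutator[of sg a b b a T] E0[OF that] E0[OF that(2,1)] by (cases "a = b") auto
  have "gl_act sg a a T = fun_scale (of_int c) T" if a: "a < k" for a
  proof
    fix w
    have "of_nat k * gl_act sg a a T w = (\<Sum>b<k. gl_act sg a a T w)" by simp
    also have "\<dots> = (\<Sum>b<k. gl_act sg b b T w)"
      using eq[OF a] by (intro sum.cong) auto
    also have "\<dots> = of_nat k * (of_int c * T w)"
      by (simp add: gl_act_euler[OF T] deg)
    finally show "gl_act sg a a T w = fun_scale (of_int c) T w" using a by simp
  qed
  with T E0 show ?thesis by (auto simp: HW_def)
qed

text \<open>
  Matrices that become the identity by adding multiples of rows to other rows, that is, products of
  transvections.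
\<close>

inductive row_reducible :: "nat \<Rightarrow> complex mat \<Rightarrow> bool" for k where
  one: "row_reducible k (1\<^sub>m k)"
| step: "A \<in> carrier_mat k k \<Longrightarrow> a < k \<Longrightarrow> b < k \<Longrightarrow> a \<noteq> b \<Longrightarrow>
    row_reducible k (addrow t a b A) \<Longrightarrow> row_reducible k A"

text \<open>
  Gauss elimination on column \<open>r\<close>, the earlier columns being those of the identity already. Scaling a
  row is not allowed, so the pivot \<open>1\<close> is produced by adding a multiple of a lower row with a nonzero entry in
  the column. In the last column there is no lower row, but there the determinant is the pivot.
\<close>

lemma det_1_row_reducible_aux:
  assumes "r \<le> k" and "A \<in> carrier_mat k k" "det A = 1"
    and "\<And>i j. j < r \<Longrightarrow> i < k \<Longrightarrow> A $$ (i, j) = (if i = j then 1 else 0)"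
  shows "row_reducible k A"
  using assms
proof (induction r arbitrary: A rule: inc_induct)
  case base
  then have "A = 1\<^sub>m k" by (intro eq_matI) auto
  then show ?case by (simp add: row_reducible.one)
next
  case (step r)
  define good where "good A \<longleftrightarrow> A \<in> carrier_mat k k \<and> det A = 1 \<and>
    (\<forall>j<r. \<forall>i<k. A $$ (i, j) = (if i = j then 1 else 0))" for A :: "complex mat"
  have good_addrow: "good (addrow t a b A)" if "good A" "a \<noteq> b" "r \<le> b" "a < k" "b < k" for A t a b
    using that by (auto simp: good_def det_addrow)
  \<comment> \<open>A pivot \<open>1\<close> clears its column, one entry after the other.\<close>
  have 1: "row_reducible k A" if "good A" "A $$ (r, r) = 1" for A
    using that
  proof (induction "card {i. i < k \<and> i \<noteq> r \<and> A $$ (i, r) \<noteq> 0}" arbitrary: A rule: less_induct)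
    case (less A)
    have A: "A \<in> carrier_mat k k" using less.prems by (simp add: good_def)
    show ?case
    proof (cases "\<exists>i<k. i \<noteq> r \<and> A $$ (i, r) \<noteq> 0")
      case False
      then show ?thesis using less.prems
        by (intro step.IH) (auto simp: good_def less_Suc_eq)
    next
      case True
      then obtain i where i: "i < k" "i \<noteq> r" "A $$ (i, r) \<noteq> 0" by blast
      let ?B = "addrow (- A $$ (i, r)) i r A"
      have "row_reducible k ?B"
      proof (rule less.hyps)
        have "?B $$ (l, r) = (if l = i then 0 else A $$ (l, r))" if "l < k" for l
          using that i A less.prems(2) step.hyps by auto
        then have "{l. l < k \<and> l \<noteq> r \<and> ?B $$ (l, r) \<noteq> 0} \<subseteq> {l. l < k \<and> l \<noteq> r \<and> A $$ (l, r) \<noteq> 0} - {i}"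
          by (auto simp del: index_mat_addrow split: if_splits)
        then have "{l. l < k \<and> l \<noteq> r \<and> ?B $$ (l, r) \<noteq> 0} \<subset> {l. l < k \<and> l \<noteq> r \<and> A $$ (l, r) \<noteq> 0}"
          using i by blast
        then show "card {l. l < k \<and> l \<noteq> r \<and> ?B $$ (l, r) \<noteq> 0} < card {l. l < k \<and> l \<noteq> r \<and> A $$ (l, r) \<noteq> 0}"
          by (intro psubset_card_mono) auto
        show "good ?B" using less.prems i step.hyps by (intro good_addrow) auto
        show "?B $$ (r, r) = 1" using less.prems i step.hyps A by auto
      qed
      then show ?thesis using row_reducible.step[OF A] i step.hyps by blast
    qed
  qed
  \<comment> \<open>A nonzero entry below the pivot position produces the pivot \<open>1\<close>.\<close>
  have 2: "row_reducible k A" if A: "good A" and i: "r < i" "i < k" "A $$ (i, r) \<noteq> 0" for A i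
  proof -
    have "row_reducible k (addrow ((1 - A $$ (r, r)) / A $$ (i, r)) r i A)"
      using A i by (intro 1 good_addrow) (auto simp: good_def)
    then show ?thesis using A i row_reducible.step[of A k r i] by (auto simp: good_def)
  qed
  have A: "good A" using step.prems by (simp add: good_def)
  show ?case
  proof (cases "\<exists>i. r < i \<and> i < k \<and> A $$ (i, r) \<noteq> 0")
    case True
    with 2[OF A] show ?thesis by blast
  next
    case False
    then have zero: "A $$ (i, r) = 0" if "r < i" "i < k" for i using that by blast
    show ?thesis
    proof (cases "Suc r = k")
      case True
      have "upper_triangular A"
        using step.prems True by (auto simp: upper_triangular_def)
      then have "det A = prod_list (diag_mat A)" using step.prems(1) by (rule det_upper_triangular)
      also have "diag_mat A = map (\<lambda>i. A $$ (i, i)) [0..<r] @ [A $$ (r, r)]"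
        using step.prems(1) True by (auto simp: diag_mat_def)
      also have "map (\<lambda>i. A $$ (i, i)) [0..<r] = replicate r 1"
        using step.prems(3) True by (intro replicate_eqI) auto
      finally show ?thesis using step.prems(2) 1[OF A] by simp
    next
      case nk: False
      have "A $$ (r, r) \<noteq> 0"
      proof
        assume rr: "A $$ (r, r) = 0"
        \<comment> \<open>If column \<open>r\<close> vanishes from row \<open>r\<close> on, it is a combination of the columns before it; \<open>v\<close> holds the coefficients of that relation.\<close>
        define v where "v = vec k (\<lambda>j. if j < r then A $$ (j, r) else if j = r then -1 else 0)"
        have "v \<in> carrier_vec k" by (simp add: v_def)
        moreover have "v $ r \<noteq> 0" using step.hyps by (simp add: v_def)
        then have "v \<noteq> 0\<^sub>v k" using step.hyps by auto
        moreover have "A *\<^sub>v v = 0\<^sub>v k"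
        proof (rule eq_vecI)
          fix i assume "i < dim_vec (0\<^sub>v k)"
          then have i: "i < k" by simp
          have "(A *\<^sub>v v) $ i = (\<Sum>j<k. A $$ (i, j) * v $ j)"
            using i step.prems(1) by (simp add: scalar_prod_def v_def lessThan_atLeast0)
          also have "\<dots> = (\<Sum>j<k. (if j = i then if i < r then A $$ (i, r) else 0 else 0) -
              (if j = r then A $$ (i, r) else 0))"
            using i step.prems(3) by (intro sum.cong refl) (auto simp: v_def)
          also have "\<dots> = 0"
            using i step.hyps zero rr by (auto simp: sum_subtractf not_less le_less)
          finally show "(A *\<^sub>v v) $ i = 0\<^sub>v k $ i" using i by simp
        qed (use step.prems(1) in simp)
        ultimately have "det A = 0" using det_0_iff_vec_prod_zero[OF step.prems(1)] by blast
        with step.prems(2) show False by simp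
      qed
      then have "row_reducible k (addrow 1 (Suc r) r A)"
        using A step.hyps nk step.prems(1) zero
        by (intro 2[of _ "Suc r"] good_addrow) auto
      then show ?thesis using row_reducible.step[OF step.prems(1), of "Suc r" r] step.hyps nk by simp
    qed
  qed
qed

lemma det_1_row_reducible: "A \<in> carrier_mat k k \<Longrightarrow> det A = 1 \<Longrightarrow> row_reducible k A"
  by (rule det_1_row_reducible_aux[of 0]) auto

abbreviation GL_act_mat :: "nat \<Rightarrow> bool list \<Rightarrow> complex mat \<Rightarrow> complex mat \<Rightarrow> (nat list \<Rightarrow> complex) \<Rightarrow> nat list \<Rightarrow> complex" where
  "GL_act_mat k sg A B \<equiv> GL_act k sg (\<lambda>i j. A $$ (i, j)) (\<lambda>i j. B $$ (i, j))"

lemma GL_act_mat_mult: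
  assumes "A \<in> carrier_mat k k" "B \<in> carrier_mat k k" "A' \<in> carrier_mat k k" "B' \<in> carrier_mat k k"
  shows "GL_act_mat k sg A B (GL_act_mat k sg A' B' T) = GL_act_mat k sg (A * A') (B' * B) T"
  unfolding GL_act_mult
  by (rule GL_act_cong) (use assms in \<open>auto simp: scalar_prod_def lessThan_atLeast0\<close>)

lemma GL_act_mat_addrow_mat:
  "GL_act_mat k sg (addrow_mat k t a b) (addrow_mat k (- t) a b) T = GL_act_transv k sg a b t T"
  by (rule GL_act_cong) (auto simp: addrow_mat_def transv_def)

lemma addrow_mat_inverse:
  fixes t :: complex
  assumes "a < k" "b < k" "a \<noteq> b"
  shows "addrow_mat k (- t) a b * addrow_mat k t a b = 1\<^sub>m k"
proof -
  have "addrow_mat k (- t) a b * addrow_mat k t a b = addrow (- t) a b (addrow_mat k t a b)"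
    using assms by (intro addrow_mat[symmetric]) auto
  also have "\<dots> = 1\<^sub>m k" using assms by (intro eq_matI) (auto simp: addrow_mat_def)
  finally show ?thesis .
qed

text \<open>
  Each transvection fixes \<open>T\<close>, since both the raising and the lowering operators kill it. The inverse matrix is
  constructed along with the row operations.
\<close>

lemma HW_fixed_if_row_reducible:
  assumes T: "T \<in> HW k sg (\<lambda>_. c)"
  shows "row_reducible k A \<Longrightarrow> A \<in> carrier_mat k k \<and>
     (\<exists>B \<in> carrier_mat k k. B * A = 1\<^sub>m k \<and> GL_act_mat k sg A B T = T)"
proof (induction rule: row_reducible.induct)
  case one
  have "GL_act_mat k sg (1\<^sub>m k) (1\<^sub>m k) T = T"
    using T by (intro GL_act_one) (auto simp: HW_def)
  then show ?case by (auto intro!: bexI[of _ "1\<^sub>m k"])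
next
  case (step A a b t)
  define P where "P t = (addrow_mat k t a b :: complex mat)" for t
  have P: "P t \<in> carrier_mat k k" for t by (simp add: P_def)
  have inv: "P (- t) * P t = 1\<^sub>m k" for t using step by (simp add: P_def addrow_mat_inverse)
  have PA: "addrow t a b A = P t * A" using step by (simp add: P_def addrow_mat[of A k k])
  from step obtain B where B: "B \<in> carrier_mat k k" "B * (P t * A) = 1\<^sub>m k"
      "GL_act_mat k sg (P t * A) B T = T" unfolding PA by blast
  have A: "P (- t) * (P t * A) = A"
    using step P inv by (simp flip: assoc_mult_mat[of _ k k _ k _ k])
  have "GL_act_mat k sg A (B * P t) T = GL_act_mat k sg (P (- t) * (P t * A)) (B * P t) T" by (simp only: A)
  also have "\<dots> = GL_act_mat k sg (P (- t)) (P t) (GL_act_mat k sg (P t * A) B T)"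
    using step(1) P B(1) by (intro GL_act_mat_mult[symmetric]) (auto intro: mult_carrier_mat)
  also have "\<dots> = GL_act_transv k sg a b (- t) T"
    unfolding B(3) using GL_act_mat_addrow_mat[of k sg "- t" a b T] by (simp add: P_def)
  also have "\<dots> = T"
    using HW_constant_lowering[OF T step(2-4)] T GL_act_transv_fixes_iff[OF _ step(2-4), of T sg]
    unfolding HW_def by blast
  finally have "GL_act_mat k sg A (B * P t) T = T" .
  moreover have "B * P t * A = 1\<^sub>m k" using B P step by (simp add: assoc_mult_mat[of _ k k _ k _ k])
  ultimately show ?case using B P step by (auto intro!: bexI[of _ "B * P t"])
qed

lemma HW_fixed_by_SL:
  assumes T: "T \<in> HW k sg (\<lambda>_. c)" and A: "A \<in> carrier_mat k k" "det A = 1"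
    and B: "B \<in> carrier_mat k k" "A * B = 1\<^sub>m k"
  shows "GL_act_mat k sg A B T = T"
proof -
  obtain B' where B': "B' \<in> carrier_mat k k" "B' * A = 1\<^sub>m k" "GL_act_mat k sg A B' T = T"
    using HW_fixed_if_row_reducible[OF T det_1_row_reducible[OF A]] by blast
  have "B' = B' * (A * B)" using B B' by simp
  also have "\<dots> = B' * A * B" using A B B' by (intro assoc_mult_mat[symmetric]) auto
  also have "\<dots> = B" using B B' by simp
  finally show ?thesis using B'(3) by simp
qed

section \<open>Coordinates on the tensor space\<close>

text \<open>
  Coordinates of a pure tensor whose factors have the coordinate functions \<open>xs\<close>.
\<close>

primrec ptens :: "nat \<Rightarrow> (nat \<Rightarrow> complex) list \<Rightarrow> nat list \<Rightarrow> complex" where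
  "ptens k [] = (\<lambda>w. if w = [] then 1 else 0)"
| "ptens k (x # xs) = (\<lambda>w. case w of [] \<Rightarrow> 0 | i # u \<Rightarrow> if i < k then x i * ptens k xs u else 0)"

lemma ptens_word_funs: "ptens k xs \<in> word_funs k (length xs)"
proof (induction xs)
  case (Cons x xs)
  have "slice i (ptens k (x # xs)) = (if i < k then fun_scale (x i) (ptens k xs) else 0)" for i
    by (auto simp: fun_eq_iff)
  moreover have "fun_scale (x i) (ptens k xs) \<in> word_funs k (length xs)" for i
    by (rule FS.subspace_scale[OF subspace_word_funs Cons])
  ultimately show ?case
    by (simp only: list.size add_0_right add_Suc_right word_funs_Suc) simp
qed (simp add: word_funs_def)

lemma ptens_append:
  "length w = length xs \<Longrightarrow> ptens k (xs @ ys) (w @ u) = ptens k xs w * ptens k ys u"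
  by (induction w xs rule: list_induct2) auto

lemma ptens_update:
  assumes "l < length xs"
  shows "ptens k (xs[l := x + y]) w = ptens k (xs[l := x]) w + ptens k (xs[l := y]) w"
    and "ptens k (xs[l := fun_scale c x]) w = c * ptens k (xs[l := x]) w"
proof -
  have "ptens k (xs[l := x + y]) w = ptens k (xs[l := x]) w + ptens k (xs[l := y]) w \<and>
      ptens k (xs[l := fun_scale c x]) w = c * ptens k (xs[l := x]) w"
    using assms
  proof (induction xs arbitrary: l w)
    case (Cons z xs)
    then show ?case by (cases l) (auto simp: algebra_simps split: list.split)
  qed simp
  then show "ptens k (xs[l := x + y]) w = ptens k (xs[l := x]) w + ptens k (xs[l := y]) w"
    and "ptens k (xs[l := fun_scale c x]) w = c * ptens k (xs[l := x]) w" by blast+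
qed

lemma ptens_units:
  "w \<in> words k (length xs) \<Longrightarrow> (\<And>l i. l < length xs \<Longrightarrow> i < k \<Longrightarrow> (xs ! l) i = (if i = w ! l then 1 else 0)) \<Longrightarrow>
     ptens k xs u = (if u = w then 1 else 0)"
proof (induction xs arbitrary: w u)
  case (Cons x xs)
  then obtain j v where w: "w = j # v" "j < k" "v \<in> words k (length xs)" by (auto simp: words_Suc)
  have x: "x i = (if i = j then 1 else 0)" if "i < k" for i
    using Cons.prems(2)[of 0 i] that w by simp
  have "ptens k xs u = (if u = v then 1 else 0)" for u
  proof (rule Cons.IH[OF w(3)])
    fix l i assume "l < length xs" "i < k"
    then show "(xs ! l) i = (if i = v ! l then 1 else 0)"
      using Cons.prems(2)[of "Suc l" i] w by simp
  qed
  then show ?case using w x by (auto split: list.split)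
qed simp

lemma ptens_GL_act:
  "length xs = length sg \<Longrightarrow> length ys = length sg \<Longrightarrow>
    (\<And>l i. l < length sg \<Longrightarrow> i < k \<Longrightarrow> (ys ! l) i = (\<Sum>j<k. (if sg ! l then A i j else B j i) * (xs ! l) j)) \<Longrightarrow>
    ptens k ys = GL_act k sg A B (ptens k xs)"
proof (induction sg arbitrary: xs ys)
  case (Cons s sg)
  then obtain x xs' y ys' where xy: "xs = x # xs'" "ys = y # ys'" by (metis length_Suc_conv)
  have IH: "ptens k ys' = GL_act k sg A B (ptens k xs')"
  proof (rule Cons.IH)
    fix l i assume "l < length sg" "i < k"
    then show "(ys' ! l) i = (\<Sum>j<k. (if sg ! l then A i j else B j i) * (xs' ! l) j)"
      using Cons.prems(3)[of "Suc l" i] xy by simp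
  qed (use Cons.prems xy in auto)
  have y: "y i = (\<Sum>j<k. (if s then A i j else B j i) * x j)" if "i < k" for i
    using Cons.prems(3)[of 0 i] that xy by simp
  have sl: "slice j (ptens k xs) = fun_scale (x j) (ptens k xs')" if "j < k" for j
    using that xy by (simp add: fun_eq_iff)
  have "GL_act k sg A B (slice j (ptens k xs)) u = x j * ptens k ys' u" if "j < k" for j u
    unfolding sl[OF that] GL_act_scale IH by simp
  then show ?case
    by (auto simp: xy(2) fun_eq_iff y sum_distrib_right mult.assoc split: list.split)
qed simp

text \<open>
  A function that is linear in each argument is determined by its values at basis elements. Linearity is
  assumed in the form of the expansion of a single argument, and \<open>D\<close> is the set of admissible arguments,
  which allows the same lemma to be used for vectors and for covectors.
\<close>

lemma multi_expand:
  assumes "\<And>xs x ys. length xs + Suc (length ys) = n \<Longrightarrow> set xs \<subseteq> D \<Longrightarrow> x \<in> D \<Longrightarrow> set ys \<subseteq> D \<Longrightarrow>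
      \<gamma> (xs @ x # ys) = (\<Sum>i<k. c x i * \<gamma> (xs @ e i # ys))"
    and e: "\<And>i. i < k \<Longrightarrow> e i \<in> D"
    and "length zs = n" "set zs \<subseteq> D"
  shows "\<gamma> zs = (\<Sum>w\<in>words k n. ptens k (map c zs) w * (\<gamma> (map e w) :: complex))"
  using assms(1,3,4)
proof (induction zs arbitrary: \<gamma> n)
  case (Cons z zs)
  then obtain n' where n: "n = Suc n'" "length zs = n'" by auto
  have inner: "\<gamma> (e i # zs) = (\<Sum>w\<in>words k n'. ptens k (map c zs) w * \<gamma> (e i # map e w))" if i: "i < k" for i
  proof (rule Cons.IH[of n' "\<lambda>zs. \<gamma> (e i # zs)"])
    fix xs x ys assume "length xs + Suc (length ys) = n'" "set xs \<subseteq> D" "x \<in> D" "set ys \<subseteq> D"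
    then show "\<gamma> (e i # xs @ x # ys) = (\<Sum>l<k. c x l * \<gamma> (e i # xs @ e l # ys))"
      using Cons.prems(1)[of "e i # xs" ys x] e[OF i] n by simp
  qed (use Cons.prems n in auto)
  have "\<gamma> (z # zs) = (\<Sum>i<k. c z i * \<gamma> (e i # zs))"
    using Cons.prems(1)[of "[]" zs z] Cons.prems n by simp
  also have "\<dots> = (\<Sum>i<k. \<Sum>w\<in>words k n'. ptens k (map c (z # zs)) (i # w) * \<gamma> (map e (i # w)))"
    by (intro sum.cong refl) (simp add: inner sum_distrib_left mult.assoc)
  finally show ?case unfolding n(1) sum_words_Suc .
qed simp

locale based_space = vector_space s for s :: "complex \<Rightarrow> 'v::ab_group_add \<Rightarrow> 'v" +
  fixes bs :: "'v list"
  assumes ob: "ordered_basis s bs"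
begin

abbreviation k :: nat where "k \<equiv> length bs"

definition crd :: "'v \<Rightarrow> nat \<Rightarrow> complex" where
  "crd v i = representation (set bs) v (bs ! i)"

definition dualb :: "nat \<Rightarrow> 'v \<Rightarrow> complex" where
  "dualb i v = crd v i"

definition cocrd :: "('v \<Rightarrow> complex) \<Rightarrow> nat \<Rightarrow> complex" where
  "cocrd \<phi> i = \<phi> (bs ! i)"

definition coords :: "'v list \<Rightarrow> ('v \<Rightarrow> complex) list \<Rightarrow> (nat \<Rightarrow> complex) list" where
  "coords vs \<phi>s = map cocrd \<phi>s @ map crd vs"

text \<open>
  A tensor is a functional on multilinear forms; its coordinates are its values at the products of
  coordinate functions. The letters of a word index the covector factors first and then the vector factors.
\<close>

definition \<Phi> :: "'v tensor \<Rightarrow> nat list \<Rightarrow> complex" where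
  "\<Phi> T w = T (\<lambda>vs \<phi>s. ptens k (coords vs \<phi>s) w)"

lemma basis: "distinct bs" "independent (set bs)" "span (set bs) = UNIV"
  using ob by (auto simp: ordered_basis_def)

lemma crd_add: "crd (v + w) = crd v + crd w"
  and crd_scale: "crd (s c v) = fun_scale c (crd v)"
  using basis by (auto simp: crd_def fun_eq_iff representation_add representation_scale)

lemma crd_basis: "i < k \<Longrightarrow> j < k \<Longrightarrow> crd (bs ! j) i = (if i = j then 1 else 0)"
  using basis by (simp add: crd_def representation_basis nth_eq_iff_index_eq)

lemma basis_expansion: "v = (\<Sum>i<k. s (crd v i) (bs ! i))"
proof -
  have "v = (\<Sum>x\<in>set bs. s (representation (set bs) v x) x)"
    by (rule sum_representation_eq[symmetric]) (use basis in auto)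
  also have "\<dots> = (\<Sum>i<k. s (crd v i) (bs ! i))"
    unfolding crd_def by (rule sum.reindex_bij_betw[symmetric, OF bij_betw_nth[OF basis(1) refl refl]])
  finally show ?thesis .
qed

lemma dual_apply: "\<phi> \<in> dual_space s \<Longrightarrow> \<phi> v = (\<Sum>i<k. crd v i * \<phi> (bs ! i))"
proof -
  assume "\<phi> \<in> dual_space s"
  then interpret p: Vector_Spaces.linear s "(*)" \<phi> by (simp add: dual_space_def)
  show ?thesis
    by (subst basis_expansion) (simp add: p.sum p.scale)
qed

lemma dualb_dual: "dualb i \<in> dual_space s"
  by (simp add: dual_space_def Vector_Spaces.linear_iff vector_space_mult vector_space_axioms dualb_def crd_add crd_scale)

lemma dual_expansion: "\<phi> \<in> dual_space s \<Longrightarrow> \<phi> = (\<Sum>i<k. fun_scale (cocrd \<phi> i) (dualb i))"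
proof
  fix v assume "\<phi> \<in> dual_space s"
  from dual_apply[OF this, of v] show "\<phi> v = (\<Sum>i<k. fun_scale (cocrd \<phi> i) (dualb i)) v"
    unfolding sum_fun_apply fun_scale_apply dualb_def cocrd_def by (simp only: mult.commute)
qed

lemma subspace_dual: "FS.subspace (dual_space s)"
  by (auto simp: FS.subspace_def dual_space_def Vector_Spaces.linear_iff vector_space_axioms
    vector_space_mult algebra_simps)

lemma coords_vector: "coords (vs[i := x]) \<phi>s = (coords vs \<phi>s)[length \<phi>s + i := crd x]"
  and coords_covector: "j < length \<phi>s \<Longrightarrow> coords vs (\<phi>s[j := \<phi>]) = (coords vs \<phi>s)[j := cocrd \<phi>]"
  by (auto simp: coords_def map_update list_update_append)

lemma length_coords: "length (coords vs \<phi>s) = length \<phi>s + length vs"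
  by (simp add: coords_def)

lemma multilinear_ptens: "multilinear s (*) p q (\<lambda>vs \<phi>s. ptens k (coords vs \<phi>s) w)"
proof -
  have [simp]: "cocrd (\<phi> + \<psi>) = cocrd \<phi> + cocrd \<psi>" "cocrd (fun_scale c \<phi>) = fun_scale c (cocrd \<phi>)" for \<phi> \<psi> c
    by (auto simp: cocrd_def fun_eq_iff)
  show ?thesis
    by (rule multilinearI)
      (simp_all add: coords_vector coords_covector crd_add crd_scale ptens_update length_coords)
qed

lemma \<Phi>_pure: "\<Phi> (pure_tensor s p q vs \<phi>s) = ptens k (coords vs \<phi>s)"
  by (simp add: \<Phi>_def pure_tensor_def multilinear_ptens fun_eq_iff)

lemma linear_\<Phi>: "Vector_Spaces.linear fun_scale fun_scale \<Phi>"
  by (simp add: Vector_Spaces.linear_iff vector_space_fun_scale fun_eq_iff \<Phi>_def)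

lemma multilinear_expansion:
  assumes \<beta>: "multilinear s (*) p q \<beta>" and args: "(vs, \<phi>s) \<in> tensor_args s p q"
  shows "\<beta> vs \<phi>s = (\<Sum>u\<in>words k q. \<Sum>w\<in>words k p.
    ptens k (coords vs \<phi>s) (u @ w) * \<beta> (map ((!) bs) w) (map dualb u))"
proof -
  have len: "length vs = p" "length \<phi>s = q" "set \<phi>s \<subseteq> dual_space s"
    using args by (auto simp: tensor_args_def)
  have vec: "\<beta> vs \<psi>s = (\<Sum>w\<in>words k p. ptens k (map crd vs) w * \<beta> (map ((!) bs) w) \<psi>s)"
    if \<psi>s: "length \<psi>s = q" "set \<psi>s \<subseteq> dual_space s" for \<psi>s
  proof (rule multi_expand[where D = UNIV])
    fix xs ys :: "'v list" and x assume l: "length xs + Suc (length ys) = p"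
    define F where "F z = \<beta> (xs @ z # ys) \<psi>s" for z
    have "F (y + z) = F y + F z" "F (s c z) = c * F z" for y z c
      using multilinear_vector[OF \<beta> _ \<psi>s, of "xs @ x # ys" "length xs"] l by (auto simp: F_def)
    then have "Vector_Spaces.linear s (*) F"
      by (simp add: Vector_Spaces.linear_iff vector_space_axioms vector_space_mult)
    then interpret F: Vector_Spaces.linear s "(*)" F .
    have "F x = (\<Sum>i<k. crd x i * F (bs ! i))"
      by (subst basis_expansion) (simp add: F.sum F.scale)
    then show "\<beta> (xs @ x # ys) \<psi>s = (\<Sum>i<k. crd x i * \<beta> (xs @ bs ! i # ys) \<psi>s)" by (simp add: F_def)
  qed (use len in auto)
  have "\<beta> vs \<phi>s = (\<Sum>u\<in>words k q. ptens k (map cocrd \<phi>s) u * \<beta> vs (map dualb u))"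
  proof (rule multi_expand[where D = "dual_space s"])
    fix xs ys :: "('v \<Rightarrow> complex) list" and \<phi>
    assume l: "length xs + Suc (length ys) = q" and D: "set xs \<subseteq> dual_space s" "\<phi> \<in> dual_space s" "set ys \<subseteq> dual_space s"
    define F where "F \<psi> = \<beta> vs (xs @ \<psi> # ys)" for \<psi>
    have F: "F (\<psi> + \<chi>) = F \<psi> + F \<chi>" "F (fun_scale c \<psi>) = c * F \<psi>"
      if "\<psi> \<in> dual_space s" "\<chi> \<in> dual_space s" for \<psi> \<chi> c
      using multilinear_covector[OF \<beta> len(1), of "xs @ \<phi> # ys" "length xs" \<psi> \<chi>] l D that by (auto simp: F_def)
    have F0: "F 0 = 0" using F(2)[OF D(2) D(2), of 0] by (simp add: zero_fun_def fun_scale_def)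
    have "(\<Sum>i\<in>I. fun_scale (a i) (dualb i)) \<in> dual_space s \<and>
        F (\<Sum>i\<in>I. fun_scale (a i) (dualb i)) = (\<Sum>i\<in>I. a i * F (dualb i))" if "finite I" for I a
      using that
    proof induction
      case empty
      show ?case by (simp only: sum.empty F0 FS.subspace_0[OF subspace_dual] simp_thms)
    next
      case (insert i I)
      let ?S = "\<Sum>i\<in>I. fun_scale (a i) (dualb i)"
      have i: "fun_scale (a i) (dualb i) \<in> dual_space s"
        by (rule FS.subspace_scale[OF subspace_dual dualb_dual])
      have S: "?S \<in> dual_space s" "F ?S = (\<Sum>i\<in>I. a i * F (dualb i))" using insert.IH by blast+
      show ?case
        using FS.subspace_add[OF subspace_dual i S(1)]
        by (simp only: sum.insert[OF insert.hyps] F(1)[OF i S(1)] F(2)[OF dualb_dual dualb_dual] S(2) simp_thms)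
    qed
    from this[of "{..<k}" "cocrd \<phi>"]
    have "F \<phi> = (\<Sum>i<k. cocrd \<phi> i * F (dualb i))"
      by (simp flip: dual_expansion[OF D(2)])
    then show "\<beta> vs (xs @ \<phi> # ys) = (\<Sum>i<k. cocrd \<phi> i * \<beta> vs (xs @ dualb i # ys))" by (simp add: F_def)
  qed (use len dualb_dual in auto)
  also have "\<dots> = (\<Sum>u\<in>words k q. ptens k (map cocrd \<phi>s) u *
      (\<Sum>w\<in>words k p. ptens k (map crd vs) w * \<beta> (map ((!) bs) w) (map dualb u)))"
    using dualb_dual by (intro sum.cong refl arg_cong2[of _ _ _ _ "(*)"] vec) (auto simp: words_def)
  also have "\<dots> = (\<Sum>u\<in>words k q. \<Sum>w\<in>words k p.
      ptens k (coords vs \<phi>s) (u @ w) * \<beta> (map ((!) bs) w) (map dualb u))"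
    using len by (intro sum.cong refl) (simp add: words_def coords_def ptens_append sum_distrib_left mult.assoc)
  finally show ?thesis .
qed

lemma tensor_space_induct:
  assumes "T \<in> tensor_space s p q" and "FS.subspace {T. P T}"
    and "\<And>vs \<phi>s. (vs, \<phi>s) \<in> tensor_args s p q \<Longrightarrow> P (pure_tensor s p q vs \<phi>s)"
  shows "P T"
proof -
  have "tensor_space s p q \<subseteq> {T. P T}"
    unfolding tensor_space_def by (rule FS.span_minimal[OF _ assms(2)]) (use assms(3) in auto)
  with assms(1) show ?thesis by blast
qed

text \<open>
  A tensor is determined by its coordinates. For pure tensors this is the expansion of the multilinear form
  at which they are evaluated.
\<close>

lemma tensor_expansion:
  assumes T: "T \<in> tensor_space s p q"
  shows "T \<beta> = (if multilinear s (*) p q \<beta> then \<Sum>u\<in>words k q. \<Sum>w\<in>words k p.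
    \<Phi> T (u @ w) * \<beta> (map ((!) bs) w) (map dualb u) else 0)"
proof (rule tensor_space_induct[OF T])
  fix vs \<phi>s assume args: "(vs, \<phi>s) \<in> tensor_args s p q"
  show "pure_tensor s p q vs \<phi>s \<beta> = (if multilinear s (*) p q \<beta> then \<Sum>u\<in>words k q. \<Sum>w\<in>words k p.
      \<Phi> (pure_tensor s p q vs \<phi>s) (u @ w) * \<beta> (map ((!) bs) w) (map dualb u) else 0)"
    unfolding \<Phi>_pure using multilinear_expansion[OF _ args] by (simp add: pure_tensor_def)
next
  have "\<Phi> 0 u = 0" "\<Phi> (S + T) u = \<Phi> S u + \<Phi> T u" "\<Phi> (fun_scale c T) u = c * \<Phi> T u" for S T c u
    by (simp_all add: \<Phi>_def)
  then show "FS.subspace {T. T \<beta> = (if multilinear s (*) p q \<beta> then \<Sum>u\<in>words k q. \<Sum>w\<in>words k p.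
      \<Phi> T (u @ w) * \<beta> (map ((!) bs) w) (map dualb u) else 0)}"
    by (cases "multilinear s (*) p q \<beta>")
      (simp_all add: FS.subspace_def distrib_right sum.distrib sum_distrib_left mult.assoc)
qed

lemma \<Phi>_eq_0: "T \<in> tensor_space s p q \<Longrightarrow> \<Phi> T = 0 \<Longrightarrow> T = 0"
  using tensor_expansion[of T p q] by (auto simp: fun_eq_iff)

lemma \<Phi>_word_funs: "T \<in> tensor_space s p q \<Longrightarrow> \<Phi> T \<in> word_funs k (q + p)"
proof (erule tensor_space_induct)
  show "\<Phi> (pure_tensor s p q vs \<phi>s) \<in> word_funs k (q + p)" if "(vs, \<phi>s) \<in> tensor_args s p q" for vs \<phi>s
    using that ptens_word_funs[of k "coords vs \<phi>s"] by (simp add: \<Phi>_pure tensor_args_def length_coords)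
  interpret L: Vector_Spaces.linear fun_scale fun_scale \<Phi> by (rule linear_\<Phi>)
  show "FS.subspace {T. \<Phi> T \<in> word_funs k (q + p)}"
    using subspace_word_funs[of k "q + p"]
    by (simp add: FS.subspace_def L.add L.scale L.zero)
qed

text \<open>
  The covector factors precede the vector factors. As the head of the list is the last step of a walk, the
  steps up are made first, which brings the walk to a partition of \<open>p\<close>.
\<close>

abbreviation signs :: "nat \<Rightarrow> nat \<Rightarrow> bool list" where
  "signs p q \<equiv> replicate q False @ replicate p True"

lemma matrix_wrt_entry: "i < k \<Longrightarrow> j < k \<Longrightarrow> matrix_wrt s bs g $$ (i, j) = crd (g (bs ! j)) i"
  by (simp add: matrix_wrt_def crd_def)

lemma crd_linear_image:
  assumes "Vector_Spaces.linear s s g" "i < k"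
  shows "crd (g v) i = (\<Sum>j<k. matrix_wrt s bs g $$ (i, j) * crd v j)"
proof -
  have "crd (g v) i = (\<Sum>j<k. crd v j * crd (g (bs ! j)) i)"
    unfolding crd_def by (rule representation_linear_image[OF vector_space_axioms assms(1) ob ob])
  also have "\<dots> = (\<Sum>j<k. matrix_wrt s bs g $$ (i, j) * crd v j)"
    using assms(2) by (intro sum.cong refl) (simp add: matrix_wrt_entry)
  finally show ?thesis .
qed

lemma linear_inverse:
  assumes "Vector_Spaces.linear s s g" "bij g"
  shows "Vector_Spaces.linear s s (inv_into UNIV g)"
  using assms bij_module_hom_imp_inv_module_hom by (simp add: module_hom_iff_linear[symmetric])

lemma linear_tensor_act: "Vector_Spaces.linear fun_scale fun_scale (tensor_act g)"
  by (simp add: Vector_Spaces.linear_iff vector_space_fun_scale fun_eq_iff tensor_act_def)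

lemma tensor_act_tensor_space:
  assumes g: "g \<in> SL s" and T: "T \<in> tensor_space s p q"
  shows "tensor_act g T \<in> tensor_space s p q"
    and "\<Phi> (tensor_act g T) =
      GL_act_mat k (signs p q) (matrix_wrt s bs g) (matrix_wrt s bs (inv_into UNIV g)) (\<Phi> T)"
proof -
  interpret L: Vector_Spaces.linear fun_scale fun_scale "tensor_act g" by (rule linear_tensor_act)
  interpret P: Vector_Spaces.linear fun_scale fun_scale \<Phi> by (rule linear_\<Phi>)
  define h where "h = inv_into UNIV g"
  have lin: "Vector_Spaces.linear s s g" "Vector_Spaces.linear s s h"
    using g linear_inverse by (auto simp: SL_def h_def)
  let ?A = "matrix_wrt s bs g" and ?B = "matrix_wrt s bs h"
  have d: "\<phi> \<circ> h \<in> dual_space s" if "\<phi> \<in> dual_space s" for \<phi>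
    using that lin(2) by (simp add: dual_space_def Vector_Spaces.linear_iff)
  note pure = tensor_act_pure[OF g, of p q, folded h_def]
  have sub: "FS.subspace (tensor_space s p q)" by (simp add: tensor_space_def)
  show "tensor_act g T \<in> tensor_space s p q"
  proof (rule tensor_space_induct[OF T])
    show "FS.subspace {T. tensor_act g T \<in> tensor_space s p q}"
      using sub by (simp add: FS.subspace_def L.add L.scale L.zero)
    fix vs \<phi>s assume "(vs, \<phi>s) \<in> tensor_args s p q"
    then have "(map g vs, map (\<lambda>\<phi>. \<phi> \<circ> h) \<phi>s) \<in> tensor_args s p q" using d by (auto simp: tensor_args_def)
    then show "tensor_act g (pure_tensor s p q vs \<phi>s) \<in> tensor_space s p q"
      unfolding pure tensor_space_def by (intro FS.span_base) force
  qed
  have "\<Phi> (tensor_act g T) = GL_act_mat k (signs p q) ?A ?B (\<Phi> T)"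
  proof (rule tensor_space_induct[OF T])
    show "FS.subspace {T. \<Phi> (tensor_act g T) = GL_act_mat k (signs p q) ?A ?B (\<Phi> T)}"
      by (simp add: FS.subspace_def L.add L.scale L.zero P.add P.scale P.zero GL_act_add GL_act_scale)
    fix vs \<phi>s assume args: "(vs, \<phi>s) \<in> tensor_args s p q"
    have len: "length vs = p" "length \<phi>s = q" "set \<phi>s \<subseteq> dual_space s"
      using args by (auto simp: tensor_args_def)
    have "ptens k (coords (map g vs) (map (\<lambda>\<phi>. \<phi> \<circ> h) \<phi>s)) =
        GL_act_mat k (signs p q) ?A ?B (ptens k (coords vs \<phi>s))"
    proof (rule ptens_GL_act)
      fix l i assume l: "l < length (signs p q)" and i: "i < k"
      show "(coords (map g vs) (map (\<lambda>\<phi>. \<phi> \<circ> h) \<phi>s) ! l) i =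
        (\<Sum>j<k. (if signs p q ! l then ?A $$ (i, j) else ?B $$ (j, i)) * (coords vs \<phi>s ! l) j)"
      proof (cases "l < q")
        case True
        then have "\<phi>s ! l \<in> dual_space s" using len nth_mem by blast
        from dual_apply[OF this, of "h (bs ! i)"] True len show ?thesis
          by (simp add: coords_def nth_append cocrd_def matrix_wrt_entry i)
      next
        case False
        then show ?thesis using l len crd_linear_image[OF lin(1) i, of "vs ! (l - q)"]
          by (simp add: coords_def nth_append)
      qed
    qed (use len in \<open>auto simp: length_coords\<close>)
    then show "\<Phi> (tensor_act g (pure_tensor s p q vs \<phi>s)) =
        GL_act_mat k (signs p q) ?A ?B (\<Phi> (pure_tensor s p q vs \<phi>s))"
      unfolding pure \<Phi>_pure .
  qed
  then show "\<Phi> (tensor_act g T) =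
      GL_act_mat k (signs p q) (matrix_wrt s bs g) (matrix_wrt s bs (inv_into UNIV g)) (\<Phi> T)"
    by (simp add: h_def)
qed

definition transvection :: "nat \<Rightarrow> nat \<Rightarrow> complex \<Rightarrow> 'v \<Rightarrow> 'v" where
  "transvection a b t v = v + s (t * crd v b) (bs ! a)"

lemma transvection:
  assumes ab: "a < k" "b < k" "a \<noteq> b"
  shows "transvection a b t \<in> SL s"
    and "inv_into UNIV (transvection a b t) = transvection a b (- t)"
    and "matrix_wrt s bs (transvection a b t) = addrow_mat k t a b"
proof -
  have lin: "Vector_Spaces.linear s s (transvection a b t)"
    by (simp add: Vector_Spaces.linear_iff vector_space_axioms transvection_def crd_add crd_scale
      algebra_simps scale_left_distrib scale_right_distrib)
  have inv: "transvection a b (- t) (transvection a b t v) = v" for t v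
    using ab by (simp add: transvection_def crd_add crd_scale crd_basis scale_minus_left)
  have inv': "transvection a b t (transvection a b (- t) v) = v" for v
    using inv[of "- t" v] by simp
  have bij: "bij (transvection a b t)"
    by (rule o_bij[of "transvection a b (- t)"]) (auto simp: fun_eq_iff inv inv')
  show "inv_into UNIV (transvection a b t) = transvection a b (- t)"
    by (rule inv_unique_comp) (auto simp: fun_eq_iff inv inv')
  show mat: "matrix_wrt s bs (transvection a b t) = addrow_mat k t a b"
  proof (rule eq_matI)
    fix i j assume "i < dim_row (addrow_mat k t a b)" "j < dim_col (addrow_mat k t a b)"
    then have ij: "i < k" "j < k" by (auto simp: addrow_mat_def)
    then show "matrix_wrt s bs (transvection a b t) $$ (i, j) = addrow_mat k t a b $$ (i, j)"
      using ab by (auto simp: matrix_wrt_entry transvection_def crd_add crd_scale crd_basis addrow_mat_def)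
  qed (auto simp: matrix_wrt_def addrow_mat_def)
  have "lin_det s (transvection a b t) = 1"
    using lin_det_eq[OF lin ob] ab by (simp add: mat det_addrow_mat)
  with lin bij show "transvection a b t \<in> SL s" by (simp add: SL_def)
qed

lemma matrix_wrt_inverse:
  assumes "g \<in> SL s"
  shows "matrix_wrt s bs g * matrix_wrt s bs (inv_into UNIV g) = 1\<^sub>m k"
proof (rule eq_matI)
  have lin: "Vector_Spaces.linear s s g" and g: "g (inv_into UNIV g x) = x" for x
    using assms by (auto simp: SL_def bij_def surj_f_inv_f)
  fix i j assume "i < dim_row (1\<^sub>m k)" "j < dim_col (1\<^sub>m k)"
  then have ij: "i < k" "j < k" by auto
  have "(matrix_wrt s bs g * matrix_wrt s bs (inv_into UNIV g)) $$ (i, j) =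
      (\<Sum>l<k. matrix_wrt s bs g $$ (i, l) * crd (inv_into UNIV g (bs ! j)) l)"
    using ij by (simp add: matrix_wrt_def crd_def scalar_prod_def lessThan_atLeast0)
  also have "\<dots> = 1\<^sub>m k $$ (i, j)"
    using ij by (simp add: g crd_basis flip: crd_linear_image[OF lin])
  finally show "(matrix_wrt s bs g * matrix_wrt s bs (inv_into UNIV g)) $$ (i, j) = 1\<^sub>m k $$ (i, j)" .
qed (auto simp: matrix_wrt_def)

text \<open>
  The pure tensors of basis elements have the indicator functions of words as coordinates.
\<close>

lemma \<Phi>_surj:
  assumes x: "x \<in> word_funs k (q + p)"
  shows "\<exists>T \<in> tensor_space s p q. \<Phi> T = x"
proof -
  interpret L: Vector_Spaces.linear fun_scale fun_scale \<Phi> by (rule linear_\<Phi>)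
  define P where "P w = pure_tensor s p q (map ((!) bs) (drop q w)) (map dualb (take q w))" for w
  define T where "T = (\<Sum>w\<in>words k (q + p). fun_scale (x w) (P w))"
  have "P w \<in> tensor_space s p q" if "w \<in> words k (q + p)" for w
    unfolding tensor_space_def P_def using that dualb_dual
    by (intro FS.span_base) (force simp: tensor_args_def words_def)
  then have "T \<in> tensor_space s p q"
    unfolding T_def tensor_space_def by (intro FS.span_sum FS.span_scale) auto
  moreover have \<Phi>P: "\<Phi> (P w) u = (if u = w then 1 else 0)" if w: "w \<in> words k (q + p)" for w u
    unfolding P_def \<Phi>_pure
  proof (rule ptens_units)
    have len: "length w = q + p" using w by (simp add: words_def)
    have lt: "w ! l < k" if "l < q + p" for l
    proof -
      have "w ! l \<in> set w" using that len by simp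
      with w show ?thesis by (auto simp: words_def)
    qed
    show "w \<in> words k (length (coords (map ((!) bs) (drop q w)) (map dualb (take q w))))"
      using w len by (simp add: length_coords)
    fix l i assume l: "l < length (coords (map ((!) bs) (drop q w)) (map dualb (take q w)))" and i: "i < k"
    then show "(coords (map ((!) bs) (drop q w)) (map dualb (take q w)) ! l) i = (if i = w ! l then 1 else 0)"
      using len lt[of l] by (auto simp: length_coords coords_def nth_append cocrd_def dualb_def crd_basis)
  qed
  have "\<Phi> T = x"
  proof
    fix u
    have "\<Phi> T u = (\<Sum>w\<in>words k (q + p). if u = w then x w else 0)"
      unfolding T_def L.sum L.scale sum_fun_apply using \<Phi>P by (intro sum.cong) auto
    also have "\<dots> = x u" using x by (auto simp: finite_words word_funs_def)
    finally show "\<Phi> T u = x u" .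
  qed
  ultimately show ?thesis by blast
qed

text \<open>
  An invariant is fixed by the transvections in particular, which gives one inclusion. For the other one, the matrix
  of an element of \<open>SL\<close> is a product of transvections.
\<close>

lemma \<Phi>_SL_invariants:
  assumes deg: "int p - int q = c * int k"
  shows "\<Phi> ` SL_invariants s p q = HW k (signs p q) (\<lambda>_. c)"
proof (intro equalityI subsetI)
  fix x assume "x \<in> \<Phi> ` SL_invariants s p q"
  then obtain T where T: "T \<in> tensor_space s p q" "x = \<Phi> T" and fixed: "\<And>g. g \<in> SL s \<Longrightarrow> tensor_act g T = T"
    by (auto simp: SL_invariants_def)
  show "x \<in> HW k (signs p q) (\<lambda>_. c)"
  proof (rule HW_if_transv_fixed)
    show "x \<in> word_funs k (length (signs p q))" using \<Phi>_word_funs[OF T(1)] T(2) by simp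
    show "sum_list (map tsign (signs p q)) = c * int k"
      using deg by (simp add: sum_list_replicate tsign_def)
    fix a b t assume ab: "a < k" "b < k" "a \<noteq> b"
    show "GL_act_transv k (signs p q) a b t x = x"
      using tensor_act_tensor_space(2)[OF transvection(1)[OF ab, of t] T(1)] fixed[OF transvection(1)[OF ab, of t]]
        GL_act_mat_addrow_mat[of k "signs p q" t a b x]
      by (simp add: transvection[OF ab] T(2))
  qed
next
  fix x assume x: "x \<in> HW k (signs p q) (\<lambda>_. c)"
  then have "x \<in> word_funs k (q + p)" by (simp add: HW_def)
  then obtain T where T: "T \<in> tensor_space s p q" "\<Phi> T = x" using \<Phi>_surj by blast
  have "tensor_act g T = T" if g: "g \<in> SL s" for g
  proof -
    interpret L: Vector_Spaces.linear fun_scale fun_scale \<Phi> by (rule linear_\<Phi>)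
    have lin: "Vector_Spaces.linear s s g" and "lin_det s g = 1" using g by (auto simp: SL_def)
    then have det: "det (matrix_wrt s bs g) = 1" using lin_det_eq[OF lin ob] by simp
    have carr: "matrix_wrt s bs f \<in> carrier_mat k k" for f by (simp add: matrix_wrt_def)
    note GL_act = tensor_act_tensor_space[OF g T(1)]
    have "\<Phi> (tensor_act g T) = \<Phi> T"
      unfolding GL_act(2) T(2) by (rule HW_fixed_by_SL[OF x carr det carr matrix_wrt_inverse[OF g]])
    then have "\<Phi> (tensor_act g T - T) = 0" by (simp add: L.diff)
    moreover have "tensor_act g T - T \<in> tensor_space s p q"
      using GL_act(1) T(1) unfolding tensor_space_def by (rule FS.span_diff)
    ultimately show ?thesis using \<Phi>_eq_0 by fastforce
  qed
  then have "T \<in> SL_invariants s p q" using T by (simp add: SL_invariants_def)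
  then show "x \<in> \<Phi> ` SL_invariants s p q" using T(2) by blast
qed

lemma SL_invariants_has_dim:
  assumes "int p - int q = c * int k"
  shows "has_dim (SL_invariants s p q) (walks k (signs p q) (\<lambda>_. c))"
proof -
  interpret L: Vector_Spaces.linear fun_scale fun_scale "tensor_act g" for g :: "'v \<Rightarrow> 'v"
    by (rule linear_tensor_act)
  have "FS.subspace (tensor_space s p q)" by (simp add: tensor_space_def)
  then have sub: "FS.subspace (SL_invariants s p q)"
    by (simp add: FS.subspace_def SL_invariants_def L.add L.scale L.zero)
  have "{T \<in> SL_invariants s p q. \<Phi> T = 0} = {0}"
  proof -
    have "\<Phi> 0 = 0" by (simp add: \<Phi>_def fun_eq_iff)
    then show ?thesis using FS.subspace_0[OF sub] \<Phi>_eq_0 by (auto simp: SL_invariants_def)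
  qed
  then have "has_dim (SL_invariants s p q) (walks k (signs p q) (\<lambda>_. c) + 0)"
    using HW_has_dim[of k "signs p q" "\<lambda>_. c"] has_dim_zero
    by (intro has_dim_extension[OF linear_\<Phi> sub]) (simp_all add: \<Phi>_SL_invariants[OF assms])
  then show ?thesis by simp
qed

end

theorem corollary4p2p3:
  fixes scale :: "complex \<Rightarrow> 'v::ab_group_add \<Rightarrow> 'v"
    and Basis :: "'v set"
    and k p q m :: nat
  assumes "finite_dimensional_vector_space scale Basis"
    and "vector_space.dim scale UNIV = k"
    and "\<bar>int p - int q\<bar> = int m * int k"
  shows "vector_space.dim fun_scale (SL_invariants scale p q) =
    (\<Sum>\<mu> | is_partition (min p q) \<mu> \<and> length \<mu> \<le> k.
       card (SYT (add_columns k m \<mu>)) * card (SYT \<mu>))"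
proof -
  interpret V: finite_dimensional_vector_space scale Basis by (rule assms(1))
  obtain bs where bs: "set bs = Basis" "distinct bs"
    using finite_distinct_list[OF V.finite_Basis] by blast
  have "ordered_basis scale bs"
    using bs V.independent_Basis V.span_Basis by (simp add: ordered_basis_def)
  then interpret B: based_space scale bs by unfold_locales
  have k: "length bs = k"
    using bs assms(2) V.dim_UNIV V.dimension_def distinct_card by metis
  define c where "c = (if p \<ge> q then int m else - int m)"
  have c: "int p - int q = c * int k" "\<bar>c\<bar> = int m"
    using assms(3) by (auto simp: c_def split: if_splits)
  have "has_dim (SL_invariants scale p q) (walks k (replicate q False @ replicate p True) (\<lambda>_. c))"
    using B.SL_invariants_has_dim[of p q c] c(1) by (simp add: k)
  then show ?thesis
    using walks_eq_sum_SYT[OF c] has_dim_dim by simp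
qed

end
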